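(* Let $\mathbf X$ be a Gaussian free field on a finite connected weighted graph with nodes $\{1,\dots,n\}$, with $X_1=0$ and Laplacian $\Lambda$. Then the error function $S\mapsto \mathrm{err}(S)$, or equivalently the function $S\mapsto\mathrm{Tr}\big(\Lambda[\overline S,\overline S]^{-1}\big)$, defined on sets $S\subseteq\{1,\dots,n\}$ containing $1$, is non-increasing and supermodular in $S$. That is, $\mathrm{err}(A)\ge\mathrm{err}(B)$ whenever $A\subseteq B$, and for all $A$ and all $x,y\in\{1,\dots,n\}$, $$\mathrm{err}(A)-\mathrm{err}(A\cup\{x\})\ \ge\ \mathrm{err}(A\cup\{y\})-\mathrm{err}(A\cup\{x,y\}).$$
   Context: Gaussian free field (GFF): Let $G=(\{1,\dots,n\},E)$ be a finite connected graph, each edge $\{i,j\}\in E$ having a finite weight $r_{ij}=r_{ji}>0$; set $r_{ij}=+\infty$ (so $1/r_{ij}=0$) if $\{i,j\}\notin E$. The GFF is the random vector $\mathbf X=(X_1,\dots,X_n)$ with $X_1=0$ and density $\rho(X_1,\dots,X_n)\propto\exp\big(-\sum_{\{i,j\}\in E}\frac{(X_i-X_j)^2}{2r_{ij}}\big)$. Its Laplacian is $\Lambda[i,i]=\sum_{t\ne i}1/r_{it}$ and $\Lambda[i,j]=-1/r_{ij}$ for $i\neq j$; $(X_2,\dots,X_n)$ is a centered Gaussian with precision (inverse covariance) matrix $\Lambda[\{2,\dots,n\},\{2,\dots,n\}]$. The variable $X_1$ is regarded as always selected for observation, so observation sets $S\subseteq\{1,\dots,n\}$ contain $1$. The average expected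 squared prediction error is $$\mathrm{err}(S)=\frac1n\sum_{i=1}^n\mathrm{Var}[X_i\mid \mathbf X_S]=\frac1n\mathrm{Tr}\big(\Lambda[\overline S,\overline S]^{-1}\big),$$ where $\mathbf X_S$ is the vector of variables indexed by $S$, $\overline S=\{1,\dots,n\}\setminus S$, and $\Lambda[A,B]$ is the submatrix with rows $A$ and columns $B$ (the trace is $0$ if $\overline S=\emptyset$). *)

theory Defs
  imports
    "HOL-Probability.Probability"
    "Jordan_Normal_Form.Gauss_Jordan_Elimination"
    "Jordan_Normal_Form.DL_Submatrix"
begin

text \<open>The nodes are \<open>1, \<dots>, n\<close>, edges are two-element sets of nodes, and \<open>r i j\<close> is the
  weight of the edge \<open>{i, j}\<close>; the values of \<open>r\<close> off the edge set are never used.\<close>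

definition weighted_connected_graph :: "nat \<Rightarrow> nat set set \<Rightarrow> (nat \<Rightarrow> nat \<Rightarrow> real) \<Rightarrow> bool" where
  "weighted_connected_graph n E r \<longleftrightarrow>
     1 \<le> n \<and>
     E \<subseteq> {{i, j} | i j. i \<in> {1..n} \<and> j \<in> {1..n} \<and> i \<noteq> j} \<and>
     (\<forall>i j. {i, j} \<in> E \<longrightarrow> r i j = r j i \<and> 0 < r i j) \<and>
     (\<forall>i\<in>{1..n}. \<forall>j\<in>{1..n}. (i, j) \<in> {(a, b). {a, b} \<in> E}\<^sup>*)"

text \<open>\<open>1 / r\<^sub>i\<^sub>j\<close> under the convention \<open>r\<^sub>i\<^sub>j = \<infinity>\<close> for non-edges.\<close>

definition conductance :: "nat set set \<Rightarrow> (nat \<Rightarrow> nat \<Rightarrow> real) \<Rightarrow> nat \<Rightarrow> nat \<Rightarrow> real" where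
  "conductance E r i j = (if {i, j} \<in> E then 1 / r i j else 0)"

text \<open>Matrix indices start at \<open>0\<close>, so entry \<open>(a, b)\<close> belongs to the nodes \<open>a + 1\<close> and \<open>b + 1\<close>;
  \<open>block\<close> takes sets of nodes.\<close>

definition laplacian :: "nat \<Rightarrow> nat set set \<Rightarrow> (nat \<Rightarrow> nat \<Rightarrow> real) \<Rightarrow> real Matrix.mat" where
  "laplacian n E r = Matrix.mat n n (\<lambda>(a, b).
     if a = b then (\<Sum>t\<in>{1..n} - {Suc a}. conductance E r (Suc a) t)
     else - conductance E r (Suc a) (Suc b))"

definition block :: "real Matrix.mat \<Rightarrow> nat set \<Rightarrow> nat set \<Rightarrow> real Matrix.mat" where
  "block L A B = submatrix L {a. Suc a \<in> A} {b. Suc b \<in> B}"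

definition mat_trace :: "real Matrix.mat \<Rightarrow> real" where
  "mat_trace A = (\<Sum>i<dim_row A. A $$ (i, i))"

definition trace_inverse :: "nat \<Rightarrow> nat set set \<Rightarrow> (nat \<Rightarrow> nat \<Rightarrow> real) \<Rightarrow> nat set \<Rightarrow> real" where
  "trace_inverse n E r S =
     mat_trace (the (mat_inverse (block (laplacian n E r) ({1..n} - S) ({1..n} - S))))"

text \<open>The sum over \<open>i < j\<close> visits every undirected edge exactly once.\<close>

definition gff_energy :: "nat set set \<Rightarrow> (nat \<Rightarrow> nat \<Rightarrow> real) \<Rightarrow> (nat \<Rightarrow> real) \<Rightarrow> real" where
  "gff_energy E r x = (\<Sum>(i, j)\<in>{(i, j). i < j \<and> {i, j} \<in> E}. (x i - x j)\<^sup>2 / (2 * r i j))"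

text \<open>The first coordinate is pinned at \<open>0\<close>, so the density refers to Lebesgue measure in the
  remaining coordinates; since \<open>M\<close> is a probability space, \<open>c\<close> is the normalising constant.\<close>

definition gaussian_free_field ::
    "nat \<Rightarrow> nat set set \<Rightarrow> (nat \<Rightarrow> nat \<Rightarrow> real) \<Rightarrow> 'a measure \<Rightarrow> (nat \<Rightarrow> 'a \<Rightarrow> real) \<Rightarrow> bool" where
  "gaussian_free_field n E r M X \<longleftrightarrow>
     prob_space M \<and>
     (\<forall>\<omega>\<in>space M. X 1 \<omega> = 0) \<and>
     (\<exists>c. distributed M (\<Pi>\<^sub>M i\<in>{2..n}. lborel) (\<lambda>\<omega>. \<lambda>i\<in>{2..n}. X i \<omega>)
            (\<lambda>x. ennreal (c * exp (- gff_energy E r (x(1 := 0))))))"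

definition observed :: "'a measure \<Rightarrow> (nat \<Rightarrow> 'a \<Rightarrow> real) \<Rightarrow> nat set \<Rightarrow> 'a measure" where
  "observed M X S = vimage_algebra (space M) (\<lambda>\<omega>. \<lambda>i\<in>S. X i \<omega>) (\<Pi>\<^sub>M i\<in>S. borel)"

text \<open>\<open>Var[X\<^sub>i | X\<^sub>S] = E[(X\<^sub>i - E[X\<^sub>i | X\<^sub>S])\<^sup>2 | X\<^sub>S]\<close>, a random variable.\<close>

definition cond_variance ::
    "'a measure \<Rightarrow> (nat \<Rightarrow> 'a \<Rightarrow> real) \<Rightarrow> nat set \<Rightarrow> nat \<Rightarrow> 'a \<Rightarrow> real" where
  "cond_variance M X S i =
     real_cond_exp M (observed M X S)
       (\<lambda>\<omega>. (X i \<omega> - real_cond_exp M (observed M X S) (X i) \<omega>)\<^sup>2)"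

text \<open>For a Gaussian vector the conditional variances are almost surely constant; taking their
  expectation turns them into numbers.\<close>

definition err :: "nat \<Rightarrow> 'a measure \<Rightarrow> (nat \<Rightarrow> 'a \<Rightarrow> real) \<Rightarrow> nat set \<Rightarrow> real" where
  "err n M X S = 1 / real n * (\<Sum>i\<in>{1..n}. integral\<^sup>L M (cond_variance M X S i))"

definition observation_sets :: "nat \<Rightarrow> nat set set" where
  "observation_sets n = {S. S \<subseteq> {1..n} \<and> 1 \<in> S}"

definition supermodular :: "nat \<Rightarrow> (nat set \<Rightarrow> real) \<Rightarrow> bool" where
  "supermodular n F \<longleftrightarrow>
     (\<forall>A\<in>observation_sets n. \<forall>x\<in>{1..n}. \<forall>y\<in>{1..n}.
        F A - F (A \<union> {x}) \<ge> F (A \<union> {y}) - F (A \<union> {x, y}))"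

end

theory Submission
  imports Defs "Jordan_Normal_Form.Determinant"
begin

text \<open>Let \<open>G\<close> be the inverse of \<open>\<Lambda>[V - S, V - S]\<close>, extended by zero (the Green function of the network
  killed on \<open>S\<close>). For a non-observed node \<open>i\<close>, the variable \<open>Y = \<Sum>\<^sub>j G\<^sub>j\<^sub>i (\<Lambda>X)\<^sub>j\<close>, summed over the
  non-observed \<open>j\<close>, differs from \<open>X\<^sub>i\<close> by a linear function of \<open>X\<^sub>S\<close>. Gaussian integration by parts
  in the coordinate \<open>j\<close> gives \<open>E[g(X\<^sub>S) (\<Lambda>X)\<^sub>j] = 0\<close> and \<open>E[g(X\<^sub>S) (\<Lambda>X)\<^sub>j Y] = \<delta>\<^sub>i\<^sub>j E[g(X\<^sub>S)]\<close>, hence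
  \<open>E[Y | X\<^sub>S] = 0\<close> and \<open>Var[X\<^sub>i | X\<^sub>S] = E[Y\<^sup>2 | X\<^sub>S] = G\<^sub>i\<^sub>i\<close>.

  Adding a node \<open>x\<close> to \<open>S\<close> replaces \<open>G\<close> by its Schur complement \<open>G\<^sub>i\<^sub>k - G\<^sub>i\<^sub>x G\<^sub>x\<^sub>k / G\<^sub>x\<^sub>x\<close>, so the trace
  drops by \<open>\<Sum>\<^sub>i G\<^sub>i\<^sub>x\<^sup>2 / G\<^sub>x\<^sub>x \<ge> 0\<close>. By the minimum principle all Green functions are entrywise
  nonnegative; this makes both \<open>G\<^sub>i\<^sub>x\<close> and the hitting probability \<open>G\<^sub>i\<^sub>x / G\<^sub>x\<^sub>x\<close>, and therefore their
  product, non-increasing in \<open>S\<close>.\<close>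

section \<open>Networks, conductances and the Laplacian as an operator\<close>

locale weighted_network =
  fixes n :: nat and E :: "nat set set" and r :: "nat \<Rightarrow> nat \<Rightarrow> real"
  assumes network: "weighted_connected_graph n E r"
begin

abbreviation "V \<equiv> {1..n}"
abbreviation "c \<equiv> conductance E r"

text \<open>The operator form of \<open>laplacian n E r\<close>: since \<open>c i i = 0\<close>, it
  is the action of that matrix on functions on \<open>V\<close>. Nodes keep their labels here; the
  index shift of the matrix appears only in \<open>green_exists\<close>.\<close>

definition Lap :: "(nat \<Rightarrow> real) \<Rightarrow> nat \<Rightarrow> real" where
  "Lap u i = (\<Sum>t\<in>V. c i t * (u i - u t))"

lemma one_in_V: "1 \<in> V"
  using network by (auto simp: weighted_connected_graph_def)

lemma edgeD:
  assumes "{i, j} \<in> E"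
  shows "i \<in> V" "j \<in> V" "i \<noteq> j" "r i j = r j i" "0 < r i j"
proof -
  obtain a b where ab: "{i, j} = {a, b}" "a \<in> V" "b \<in> V" "a \<noteq> b"
    using network assms unfolding weighted_connected_graph_def by blast
  then show "i \<in> V" "j \<in> V" "i \<noteq> j" by (auto simp: doubleton_eq_iff)
  show "r i j = r j i" "0 < r i j"
    using network assms unfolding weighted_connected_graph_def by blast+
qed

lemma path_from_1: "i \<in> V \<Longrightarrow> (1, i) \<in> {(a, b). {a, b} \<in> E}\<^sup>*"
  using network one_in_V unfolding weighted_connected_graph_def by blast

lemma c_sym: "c i j = c j i"
  using edgeD(4)[of i j] by (auto simp: conductance_def insert_commute)

lemma c_nonneg: "0 \<le> c i j"
  using edgeD(5)[of i j] by (auto simp: conductance_def less_imp_le)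

lemma c_pos: "{i, j} \<in> E \<Longrightarrow> 0 < c i j"
  using edgeD(5)[of i j] by (auto simp: conductance_def)

lemma c_diag [simp]: "c i i = 0"
  using edgeD(3)[of i i] by (auto simp: conductance_def)

subsection \<open>The minimum principle\<close>

lemma Lap_add: "Lap (\<lambda>i. u i + v i) i = Lap u i + Lap v i"
  by (simp add: Lap_def algebra_simps sum.distrib sum_subtractf)

lemma Lap_scale: "Lap (\<lambda>i. a * u i) i = a * Lap u i"
  by (simp add: Lap_def algebra_simps sum_distrib_left sum_subtractf)

lemma Lap_zero: "Lap (\<lambda>_. 0) i = 0"
  by (simp add: Lap_def)

lemma Lap_diff: "Lap (\<lambda>i. u i - v i) i = Lap u i - Lap v i"
  by (simp add: Lap_def algebra_simps sum.distrib sum_subtractf)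

lemma Lap_cong: "(\<And>t. t \<in> V \<Longrightarrow> u t = v t) \<Longrightarrow> i \<in> V \<Longrightarrow> Lap u i = Lap v i"
  unfolding Lap_def by (intro sum.cong) auto

text \<open>Only the cross term could distinguish \<open>u\<close> from \<open>v\<close>, and
  exchanging its summation indices exchanges them because \<open>c\<close> is symmetric.\<close>

lemma Lap_symmetric: "(\<Sum>i\<in>V. u i * Lap v i) = (\<Sum>i\<in>V. v i * Lap u i)"
proof -
  have *: "(\<Sum>i\<in>V. a i * Lap b i) =
      (\<Sum>i\<in>V. \<Sum>t\<in>V. c i t * a i * b i) - (\<Sum>i\<in>V. \<Sum>t\<in>V. c i t * a i * b t)" for a b
    by (simp add: Lap_def sum_distrib_left sum_subtractf algebra_simps)
  have "(\<Sum>i\<in>V. \<Sum>t\<in>V. c i t * u i * v t) = (\<Sum>i\<in>V. \<Sum>t\<in>V. c i t * v i * u t)"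
    by (subst sum.swap) (simp add: c_sym algebra_simps)
  then show ?thesis
    unfolding * by (simp add: algebra_simps)
qed

text \<open>At a node where a negative minimum is attained, \<open>Lap u\<close> is a sum of
  nonpositive terms. Being nonnegative, it forces the same value on all neighbours; connectedness
  carries the minimum to node 1, which lies in \<open>S\<close>, where \<open>u\<close> is
  nonnegative.\<close>

lemma minimum_principle:
  assumes S: "S \<in> observation_sets n"
    and Lap: "\<And>i. i \<in> V - S \<Longrightarrow> 0 \<le> Lap u i"
    and bdry: "\<And>i. i \<in> S \<Longrightarrow> 0 \<le> u i"
    and i: "i \<in> V"
  shows "0 \<le> u i"
proof (rule ccontr)
  assume neg: "\<not> 0 \<le> u i"
  define m where "m = Min (u ` V)"
  have m_le: "m \<le> u k" if "k \<in> V" for k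
    using that by (simp add: m_def)
  have "m < 0" using m_le[OF i] neg by simp
  have "m \<in> u ` V" unfolding m_def using one_in_V by (intro Min_in) auto
  then obtain a where a: "a \<in> V" "u a = m" by auto
  have step: "u b' = m" if "{b, b'} \<in> E" "u b = m" for b b'
  proof (rule ccontr)
    assume "u b' \<noteq> m"
    with edgeD(2)[OF that(1)] m_le have gt: "m < u b'" by (simp add: less_le)
    have bV: "b \<in> V" using edgeD that(1) by blast
    have "b \<notin> S" using bdry[of b] that \<open>m < 0\<close> by auto
    then have "0 \<le> Lap u b" using bV Lap by blast
    also have "Lap u b < (\<Sum>t\<in>V. 0)"
      unfolding Lap_def
    proof (rule sum_strict_mono_ex1)
      show "\<forall>t\<in>V. c b t * (u b - u t) \<le> 0"
        using m_le c_nonneg that(2) by (auto intro!: mult_nonneg_nonpos)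
      show "\<exists>t\<in>V. c b t * (u b - u t) < 0"
        using edgeD(2)[OF that(1)] gt that c_pos[OF that(1)] by (auto intro!: bexI[of _ b'] mult_pos_neg)
    qed simp
    finally show False by simp
  qed
  have "(a, 1) \<in> {(a, b). {a, b} \<in> E}\<^sup>*"
    using network a(1) one_in_V unfolding weighted_connected_graph_def by blast
  then have "u 1 = m"
    by (induction rule: rtrancl_induct) (use a step in auto)
  moreover have "0 \<le> u 1" using bdry S by (auto simp: observation_sets_def)
  ultimately show False using \<open>m < 0\<close> by simp
qed

text \<open>The minimum principle applied to \<open>u - v\<close> and to
  \<open>v - u\<close>.\<close>

lemma harmonic_unique:
  assumes S: "S \<in> observation_sets n"
    and Lap: "\<And>i. i \<in> V - S \<Longrightarrow> Lap u i = Lap v i"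
    and bdry: "\<And>i. i \<in> S \<Longrightarrow> u i = v i"
    and i: "i \<in> V"
  shows "u i = v i"
proof -
  have "0 \<le> u i - v i"
    by (rule minimum_principle[OF S _ _ i]) (auto simp: Lap_diff Lap bdry)
  moreover have "0 \<le> v i - u i"
    by (rule minimum_principle[OF S _ _ i]) (auto simp: Lap_diff Lap bdry)
  ultimately show ?thesis by simp
qed

subsection \<open>Green functions\<close>

text \<open>Column \<open>k\<close> is the potential of a unit source at \<open>k\<close>, grounded
  on \<open>S\<close>. For the zero extension, the inverse-matrix equation becomes an equation for
  \<open>Lap\<close>, so the minimum principle applies column by column.\<close>

definition green :: "nat set \<Rightarrow> (nat \<Rightarrow> nat \<Rightarrow> real) \<Rightarrow> bool" where
  "green S G \<longleftrightarrow>
     (\<forall>i k. i \<notin> V - S \<or> k \<notin> V - S \<longrightarrow> G i k = 0) \<and>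
     (\<forall>i\<in>V - S. \<forall>k\<in>V - S. Lap (\<lambda>t. G t k) i = (if i = k then 1 else 0))"

lemma green_zero: "green S G \<Longrightarrow> i \<notin> V - S \<or> k \<notin> V - S \<Longrightarrow> G i k = 0"
  unfolding green_def by blast

lemma green_Lap:
  "green S G \<Longrightarrow> i \<in> V - S \<Longrightarrow> k \<in> V - S \<Longrightarrow> Lap (\<lambda>t. G t k) i = (if i = k then 1 else 0)"
  unfolding green_def by blast

lemma green_unique:
  assumes S: "S \<in> observation_sets n" and G: "green S G" and H: "green S H"
  shows "G = H"
proof (intro ext)
  fix i k
  show "G i k = H i k"
  proof (cases "i \<in> V - S \<and> k \<in> V - S")
    case True
    then have i: "i \<in> V" and k: "k \<in> V - S" by blast+
    show ?thesis
    proof (rule harmonic_unique[OF S _ _ i, of "\<lambda>t. G t k" "\<lambda>t. H t k"])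
      show "Lap (\<lambda>t. G t k) j = Lap (\<lambda>t. H t k) j" if "j \<in> V - S" for j
        unfolding green_Lap[OF G that k] green_Lap[OF H that k] ..
      show "G j k = H j k" if "j \<in> S" for j
        using green_zero[OF G, of j k] green_zero[OF H, of j k] that by simp
    qed
  next
    case False
    then show ?thesis using green_zero[OF G] green_zero[OF H] by metis
  qed
qed

lemma green_nonneg:
  assumes S: "S \<in> observation_sets n" and G: "green S G"
  shows "0 \<le> G i k"
proof (cases "i \<in> V - S \<and> k \<in> V - S")
  case True
  then have i: "i \<in> V" and k: "k \<in> V - S" by blast+
  show ?thesis
  proof (rule minimum_principle[OF S _ _ i, of "\<lambda>t. G t k"])
    show "0 \<le> Lap (\<lambda>t. G t k) j" if "j \<in> V - S" for j
      unfolding green_Lap[OF G that k] by simp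
    show "0 \<le> G j k" if "j \<in> S" for j
      using green_zero[OF G, of j k] that by simp
  qed
next
  case False
  then show ?thesis using green_zero[OF G, of i k] by auto
qed

text \<open>At the source, dropping the nonpositive neighbour terms from \<open>Lap\<close> leaves 1
  \<le> (sum of the conductances at \<open>k\<close>) * \<open>G k k\<close>, which excludes
  0.\<close>

lemma green_diag_pos:
  assumes S: "S \<in> observation_sets n" and G: "green S G" and k: "k \<in> V - S"
  shows "0 < G k k"
proof -
  have "1 = Lap (\<lambda>t. G t k) k" using green_Lap[OF G k k] by simp
  also have "\<dots> \<le> (\<Sum>t\<in>V. c k t * G k k)"
    unfolding Lap_def using green_nonneg[OF S G] c_nonneg
    by (intro sum_mono mult_left_mono) auto
  also have "\<dots> = (\<Sum>t\<in>V. c k t) * G k k" by (simp add: sum_distrib_right)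
  finally have "G k k \<noteq> 0" by auto
  then show ?thesis using green_nonneg[OF S G, of k k] by simp
qed

text \<open>Off \<open>S\<close> the Laplacian of column \<open>i\<close> is a Kronecker delta, so
  only the value at the source and boundary terms survive. This yields both the symmetry of
  \<open>G\<close> and the splitting of \<open>X i\<close> into predictor and residual.\<close>

lemma green_sum_Lap:
  assumes G: "green S G" and i: "i \<in> V - S" and S: "S \<subseteq> V"
  shows "(\<Sum>j\<in>V. Lap (\<lambda>t. G t i) j * x j) = x i + (\<Sum>l\<in>S. Lap (\<lambda>t. G t i) l * x l)"
proof -
  have "(\<Sum>j\<in>V. Lap (\<lambda>t. G t i) j * x j) =
      (\<Sum>j\<in>V - S. Lap (\<lambda>t. G t i) j * x j) + (\<Sum>l\<in>S. Lap (\<lambda>t. G t i) l * x l)"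
    using S by (intro sum.subset_diff) auto
  also have "(\<Sum>j\<in>V - S. Lap (\<lambda>t. G t i) j * x j) = (\<Sum>j\<in>V - S. if j = i then x j else 0)"
    using green_Lap[OF G _ i] by (intro sum.cong) auto
  also have "\<dots> = x i" using i by simp
  finally show ?thesis .
qed

text \<open>Columns \<open>i\<close> and \<open>k\<close> are paired by
  \<open>green_sum_Lap\<close>: the boundary terms vanish because \<open>G\<close> is zero on
  \<open>S\<close>, and \<open>Lap_symmetric\<close> exchanges the columns.\<close>

lemma green_sym:
  assumes G: "green S G" and S: "S \<in> observation_sets n"
  shows "G i k = G k i"
proof (cases "i \<in> V - S \<and> k \<in> V - S")
  case True
  have SV: "S \<subseteq> V" using S by (simp add: observation_sets_def)
  have *: "(\<Sum>j\<in>V. Lap (\<lambda>t. G t a) j * G j b) = G a b" if "a \<in> V - S" for a b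
    using green_sum_Lap[OF G that SV, of "\<lambda>j. G j b"] green_zero[OF G] by simp
  have "G i k = (\<Sum>j\<in>V. G j k * Lap (\<lambda>t. G t i) j)" using *[of i k] True by (simp add: mult.commute)
  also have "\<dots> = (\<Sum>j\<in>V. G j i * Lap (\<lambda>t. G t k) j)" by (rule Lap_symmetric)
  also have "\<dots> = G k i" using *[of k i] True by (simp add: mult.commute)
  finally show ?thesis .
next
  case False
  then show ?thesis using green_zero[OF G] by metis
qed

text \<open>The multiple of column \<open>x\<close> is chosen to cancel column \<open>k\<close> at
  \<open>x\<close>. Off \<open>S \<union> {x}\<close> column \<open>x\<close> is harmonic, so
  subtracting it leaves the source equation intact.\<close>

lemma green_insert:
  assumes S: "S \<in> observation_sets n" and G: "green S G" and x: "x \<in> V - S"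
  shows "green (S \<union> {x}) (\<lambda>i k. G i k - G i x * G x k / G x x)"
proof -
  have Gx: "G x x \<noteq> 0" using green_diag_pos[OF S G x] by simp
  have "Lap (\<lambda>t. G t k - G t x * G x k / G x x) i = (if i = k then 1 else 0)"
    if i: "i \<in> V - (S \<union> {x})" and k: "k \<in> V - (S \<union> {x})" for i k
  proof -
    have "(\<lambda>t. G t k - G t x * G x k / G x x) = (\<lambda>t. G t k - (G x k / G x x) * G t x)"
      by (simp add: mult.commute)
    then have "Lap (\<lambda>t. G t k - G t x * G x k / G x x) i =
        Lap (\<lambda>t. G t k) i - (G x k / G x x) * Lap (\<lambda>t. G t x) i"
      by (simp only: Lap_diff Lap_scale)
    then show ?thesis using green_Lap[OF G] i k x by auto
  qed
  moreover have "G i k - G i x * G x k / G x x = 0"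
    if "i \<notin> V - (S \<union> {x}) \<or> k \<notin> V - (S \<union> {x})" for i k
    using that Gx green_zero[OF G] by (cases "i = x"; cases "k = x") auto
  ultimately show ?thesis unfolding green_def by blast
qed

text \<open>The passage from matrices to functions on nodes. Invertibility follows from uniqueness:
  a kernel vector of the block, extended by zero, is harmonic off \<open>S\<close> and zero on
  \<open>S\<close>, hence zero.\<close>

lemma green_exists:
  assumes S: "S \<in> observation_sets n"
  obtains G where "green S G" "trace_inverse n E r S = (\<Sum>i\<in>V. G i i)"
    "invertible_mat (block (laplacian n E r) (V - S) (V - S))"
proof -
  \<comment> \<open>Row \<open>a\<close> of the Laplacian belongs to node \<open>a + 1\<close>.
    \<open>p\<close> sends a position in the block to its node; \<open>q\<close> inverts it by
    counting the smaller indices in \<open>I\<close>.\<close>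
  define I where "I = {a. Suc a \<in> V - S}"
  define m where "m = card I"
  define p where "p a = Suc (pick I a)" for a
  define q where "q i = card {a \<in> I. a < i - 1}" for i
  define B where "B = block (laplacian n E r) (V - S) (V - S)"
  have finI: "finite I" unfolding I_def by (rule finite_subset[of _ "{..n}"]) auto
  have In: "{i. i < n \<and> i \<in> I} = I" unfolding I_def by auto
  have pickI: "pick I a \<in> I" if "a < m" for a
    using pick_in_set_le that by (simp add: m_def)
  have p_in: "p a \<in> V - S" if "a < m" for a
    using pickI[OF that] by (simp add: p_def I_def)
  have q_p: "q (p a) = a" if "a < m" for a
    using card_pick_le that by (simp add: p_def q_def m_def)
  have q_less: "q i < m" if "i \<in> V - S" for i
  proof -
    have iI: "i - 1 \<in> I" using that by (auto simp: I_def)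
    have "{a \<in> I. a < i - 1} \<subset> I" using iI by auto
    then show ?thesis unfolding q_def m_def using psubset_card_mono[OF finI] by blast
  qed
  have p_q: "p (q i) = i" if "i \<in> V - S" for i
  proof -
    have iI: "i - 1 \<in> I" using that by (auto simp: I_def)
    show ?thesis using pick_card_in_set[OF iI] that by (auto simp: p_def q_def)
  qed
  have bij: "bij_betw p {..<m} (V - S)"
    by (rule bij_betw_byWitness[where f' = q]) (use p_in q_p q_less p_q in auto)
  have Bc: "B \<in> carrier_mat m m"
    unfolding B_def block_def laplacian_def
    by (intro carrier_matI)
      (simp_all only: dim_submatrix dim_row_mat dim_col_mat I_def[symmetric] In m_def)
  have Bij: "B $$ (a, b) = (if a = b then \<Sum>t\<in>V. c (p a) t else - c (p a) (p b))"
    if ab: "a < m" "b < m" for a b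
  proof -
    have "B $$ (a, b) = laplacian n E r $$ (pick I a, pick I b)"
      unfolding B_def block_def I_def[symmetric] using ab
      by (subst submatrix_index) (simp_all add: laplacian_def In m_def)
    moreover have "pick I a < n" "pick I b < n" 
      using In pickI[OF ab(1)] pickI[OF ab(2)] by blast+
    moreover have "pick I a = pick I b \<longleftrightarrow> a = b"
      using q_p ab unfolding p_def by metis
    moreover have "(\<Sum>t\<in>V - {p a}. c (p a) t) = (\<Sum>t\<in>V. c (p a) t)"
      by (rule sum.mono_neutral_left) auto
    ultimately show ?thesis by (auto simp: laplacian_def p_def)
  qed
  \<comment> \<open>The dictionary: the block acts on a vector as \<open>Lap\<close> acts on its
    zero extension. It serves both for the kernel and for the columns of the inverse.\<close>
  have B_Lap: "(\<Sum>b<m. B $$ (a, b) * w b) = Lap (\<lambda>i. if i \<in> V - S then w (q i) else 0) (p a)"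
    (is "_ = Lap ?u _") if a: "a < m" for a w
  proof -
    have pa: "p a \<in> V - S" by (rule p_in[OF a])
    have "(\<Sum>b<m. B $$ (a, b) * w b) =
        (\<Sum>b<m. (if a = b then (\<Sum>t\<in>V. c (p a) t) * w a else 0) - c (p a) (p b) * w b)"
      using a by (intro sum.cong) (auto simp: Bij)
    also have "\<dots> = (\<Sum>t\<in>V. c (p a) t) * w a - (\<Sum>b<m. c (p a) (p b) * w b)"
      using a by (simp add: sum_subtractf)
    also have "(\<Sum>b<m. c (p a) (p b) * w b) = (\<Sum>b<m. c (p a) (p b) * ?u (p b))"
      using p_in q_p by (intro sum.cong) auto
    also have "\<dots> = (\<Sum>t\<in>V - S. c (p a) t * ?u t)"
      by (rule sum.reindex_bij_betw[OF bij, of "\<lambda>t. c (p a) t * ?u t"])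
    also have "\<dots> = (\<Sum>t\<in>V. c (p a) t * ?u t)"
      by (rule sum.mono_neutral_left) auto
    also have "w a = ?u (p a)" using pa q_p[OF a] by simp
    finally show ?thesis
      by (simp only: Lap_def right_diff_distrib sum_subtractf sum_distrib_right)
  qed
  have "Determinant.det B \<noteq> 0"
  proof
    assume "Determinant.det B = 0"
    then obtain v where v: "v \<in> carrier_vec m" "v \<noteq> 0\<^sub>v m" "B *\<^sub>v v = 0\<^sub>v m"
      using det_0_iff_vec_prod_zero_field[OF Bc] by blast
    define w where "w b = vec_index v b" for b
    define u where "u = (\<lambda>i. if i \<in> V - S then w (q i) else 0)"
    have "Lap u (p a) = 0" if "a < m" for a
    proof -
      have "Lap u (p a) = (\<Sum>b<m. B $$ (a, b) * w b)" unfolding u_def using B_Lap[OF that] by simp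
      also have "\<dots> = vec_index (B *\<^sub>v v) a"
        using that Bc v(1) by (simp add: scalar_prod_def w_def atLeast0LessThan)
      also have "\<dots> = 0" using v(3) that by simp
      finally show ?thesis .
    qed
    then have "Lap u i = Lap (\<lambda>_. 0) i" if "i \<in> V - S" for i
      using p_q[OF that] q_less[OF that] unfolding Lap_zero by metis
    moreover have "u i = 0" if "i \<in> S" for i using that by (simp add: u_def)
    ultimately have u0: "u i = 0" if "i \<in> V" for i
      using that by (rule harmonic_unique[OF S])
    have "w b = 0" if "b < m" for b
    proof -
      have "u (p b) = 0" using u0 p_in[OF that] by blast
      then show ?thesis using p_in[OF that] q_p[OF that] by (simp add: u_def)
    qed
    then have "v = 0\<^sub>v m" using v(1) unfolding w_def by (intro eq_vecI) simp_all
    then show False using v(2) by simp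
  qed
  then have "B \<in> Units (ring_mat TYPE(real) m ())"
    by (rule det_non_zero_imp_unit[OF Bc])
  then obtain C where C: "mat_inverse B = Some C"
    using mat_inverse(1)[OF Bc, of "()"] by blast
  then have BC: "B * C = 1\<^sub>m m" "C * B = 1\<^sub>m m" "C \<in> carrier_mat m m"
    using mat_inverse(2)[OF Bc] by auto
  \<comment> \<open>The inverse relabelled by nodes; \<open>B * C = 1\<^sub>m m\<close>, read column
    by column, is the Green equation.\<close>
  define G where "G i k = (if i \<in> V - S \<and> k \<in> V - S then C $$ (q i, q k) else 0)" for i k
  have "Lap (\<lambda>t. G t k) i = (if i = k then 1 else 0)" if i: "i \<in> V - S" and k: "k \<in> V - S" for i k
  proof -
    have "(\<lambda>t. G t k) = (\<lambda>t. if t \<in> V - S then C $$ (q t, q k) else 0)"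
      using k by (auto simp: G_def)
    then have "Lap (\<lambda>t. G t k) i = Lap (\<lambda>t. if t \<in> V - S then C $$ (q t, q k) else 0) (p (q i))"
      using p_q[OF i] by simp
    also have "\<dots> = (\<Sum>b<m. B $$ (q i, b) * C $$ (b, q k))"
      using B_Lap[OF q_less[OF i], of "\<lambda>b. C $$ (b, q k)"] by simp
    also have "\<dots> = (B * C) $$ (q i, q k)"
      using q_less i k Bc BC(3) by (simp add: scalar_prod_def atLeast0LessThan)
    also have "\<dots> = (if q i = q k then 1 else 0)" using BC q_less i k by simp
    also have "q i = q k \<longleftrightarrow> i = k" using p_q i k by metis
    finally show ?thesis .
  qed
  then have "green S G" unfolding green_def G_def by auto
  moreover have "trace_inverse n E r S = (\<Sum>i\<in>V. G i i)"
  proof -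
    have "trace_inverse n E r S = (\<Sum>a<m. C $$ (a, a))"
      using C BC(3) unfolding trace_inverse_def B_def[symmetric] by (simp add: mat_trace_def)
    also have "\<dots> = (\<Sum>a<m. G (p a) (p a))"
      using p_in q_p by (intro sum.cong) (auto simp: G_def)
    also have "\<dots> = (\<Sum>i\<in>V - S. G i i)"
      by (rule sum.reindex_bij_betw[OF bij, of "\<lambda>i. G i i"])
    also have "\<dots> = (\<Sum>i\<in>V. G i i)"
      by (rule sum.mono_neutral_left) (auto simp: G_def)
    finally show ?thesis .
  qed
  moreover have "invertible_mat B"
    using BC Bc unfolding invertible_mat_def inverts_mat_def by auto
  ultimately show ?thesis using that unfolding B_def by blast
qed

subsection \<open>The trace of the Green function\<close>

text \<open>By uniqueness the trace may be computed from any Green function, in particular from the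
  Schur complement of \<open>green_insert\<close>.\<close>

lemma trace_inverse_eq:
  assumes S: "S \<in> observation_sets n" and G: "green S G"
  shows "trace_inverse n E r S = (\<Sum>i\<in>V. G i i)"
proof -
  obtain H where H: "green S H" and tr: "trace_inverse n E r S = (\<Sum>i\<in>V. H i i)"
    using green_exists[OF S] by blast
  show ?thesis using tr unfolding green_unique[OF S H G] .
qed

lemma observation_sets_insert:
  "S \<in> observation_sets n \<Longrightarrow> x \<in> V \<Longrightarrow> S \<union> {x} \<in> observation_sets n"
  by (auto simp: observation_sets_def)

text \<open>The diagonal of the Schur complement correction; the symmetry of \<open>G\<close> turns
  its products into squares.\<close>

lemma trace_inverse_insert:
  assumes S: "S \<in> observation_sets n" and G: "green S G" and x: "x \<in> V - S"
  shows "trace_inverse n E r S - trace_inverse n E r (S \<union> {x}) = (\<Sum>i\<in>V. (G i x)\<^sup>2 / G x x)"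
proof -
  have "trace_inverse n E r (S \<union> {x}) = (\<Sum>i\<in>V. G i i - G i x * G x i / G x x)"
    using x by (intro trace_inverse_eq[OF observation_sets_insert[OF S] green_insert[OF S G x]]) auto
  moreover have "G i x * G x i / G x x = (G i x)\<^sup>2 / G x x" for i
    unfolding green_sym[OF G S, of x i] power2_eq_square ..
  ultimately show ?thesis
    by (simp add: trace_inverse_eq[OF S G] sum_subtractf)
qed

lemma trace_inverse_insert_le:
  assumes S: "S \<in> observation_sets n" and x: "x \<in> V"
  shows "trace_inverse n E r (S \<union> {x}) \<le> trace_inverse n E r S"
proof (cases "x \<in> S")
  case True
  then show ?thesis by (simp add: insert_absorb)
next
  case False
  obtain G where G: "green S G" using green_exists[OF S] by blast
  have "0 \<le> (\<Sum>i\<in>V. (G i x)\<^sup>2 / G x x)"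
    using green_nonneg[OF S G] by (intro sum_nonneg) auto
  also have "\<dots> = trace_inverse n E r S - trace_inverse n E r (S \<union> {x})"
    using trace_inverse_insert[OF S G] x False by simp
  finally show ?thesis by simp
qed

text \<open>The nodes of \<open>B - A\<close> are added one at a time.\<close>

lemma trace_inverse_antimono: "antimono_on (observation_sets n) (trace_inverse n E r)"
proof (rule monotone_onI)
  fix A B assume A: "A \<in> observation_sets n" and B: "B \<in> observation_sets n" and AB: "A \<subseteq> B"
  have "trace_inverse n E r (A \<union> D) \<le> trace_inverse n E r A" if "finite D" "D \<subseteq> V" for D
    using that
  proof (induction D)
    case (insert x D)
    have "A \<union> D \<in> observation_sets n" using A insert by (auto simp: observation_sets_def)
    from trace_inverse_insert_le[OF this, of x] insert show ?case by simp
  qed simp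
  from this[of "B - A"] show "trace_inverse n E r B \<le> trace_inverse n E r A"
    using AB B finite_subset[of "B - A" V] by (auto simp: observation_sets_def Un_absorb1)
qed

text \<open>Proved summand by summand, with \<open>G\<close> for \<open>S\<close> and
  \<open>H\<close> for \<open>S \<union> {y}\<close>: a summand is the product of
  \<open>G i x\<close> and the ratio \<open>G i x / G x x\<close>, and neither factor increases on
  passing to \<open>H\<close>.\<close>

lemma trace_decrement_mono:
  assumes S: "S \<in> observation_sets n" and x: "x \<in> V - S" and y: "y \<in> V - S" and xy: "x \<noteq> y"
  shows "trace_inverse n E r (S \<union> {y}) - trace_inverse n E r (S \<union> {y} \<union> {x}) \<le>
    trace_inverse n E r S - trace_inverse n E r (S \<union> {x})"
proof -
  obtain G where G: "green S G" using green_exists[OF S] by blast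
  define H where "H i k = G i k - G i y * G y k / G y y" for i k
  have Sy: "S \<union> {y} \<in> observation_sets n" using observation_sets_insert[OF S] y by blast
  have H: "green (S \<union> {y}) H" unfolding H_def by (rule green_insert[OF S G y])
  have xH: "x \<in> V - (S \<union> {y})" using x xy by simp
  have Gx: "0 < G x x" by (rule green_diag_pos[OF S G x])
  have Gy: "0 < G y y" by (rule green_diag_pos[OF S G y])
  have Hx: "0 < H x x" by (rule green_diag_pos[OF Sy H xH])
  \<comment> \<open>The Green function with \<open>x\<close> observed in place of \<open>y\<close>;
    its nonnegativity is what compares the ratios.\<close>
  have "green (S \<union> {x}) (\<lambda>i k. G i k - G i x * G x k / G x x)" by (rule green_insert[OF S G x])
  then have K: "0 \<le> G i y - G i x * G x y / G x x" for i
    using green_nonneg[OF observation_sets_insert[OF S]] x by blast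
  have "(H i x)\<^sup>2 / H x x \<le> (G i x)\<^sup>2 / G x x" for i
  proof -
    have H_le: "H i x \<le> G i x"
      using green_nonneg[OF S G] Gy by (simp add: H_def)
    \<comment> \<open>The entry from \<open>K\<close>, times this nonnegative factor, is exactly the
      cross-multiplied difference of the ratios,
      \<open>G i x * H x x - H i x * G x x\<close>.\<close>
    have "0 \<le> (G i y - G i x * G x y / G x x) * (G x x * G x y / G y y)"
      using K green_nonneg[OF S G] by (intro mult_nonneg_nonneg divide_nonneg_nonneg) auto
    also have "\<dots> = G i y * (G x x * G x y / G y y) - G i x * G x y * G x y / G y y"
      using Gx unfolding left_diff_distrib by simp
    also have "\<dots> = G i x * H x x - H i x * G x x"
      unfolding H_def green_sym[OF G S, of y x] by (simp add: algebra_simps)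
    finally have "H i x * G x x \<le> G i x * H x x" by simp
    then have "H i x / H x x \<le> G i x / G x x" using Gx Hx by (simp add: field_simps)
    then have "H i x * (H i x / H x x) \<le> G i x * (G i x / G x x)"
      using H_le green_nonneg[OF Sy H] green_nonneg[OF S G] by (intro mult_mono) auto
    then show ?thesis by (simp add: power2_eq_square)
  qed
  then show ?thesis
    unfolding trace_inverse_insert[OF S G x] trace_inverse_insert[OF Sy H xH]
    by (intro sum_mono)
qed

lemma trace_inverse_supermodular: "supermodular n (trace_inverse n E r)"
  unfolding supermodular_def
proof (intro ballI)
  fix A x y assume A: "A \<in> observation_sets n" and x: "x \<in> V" and y: "y \<in> V"
  let ?F = "trace_inverse n E r"
  have eq: "A \<union> {x, y} = A \<union> {y} \<union> {x}" by auto
  \<comment> \<open>If \<open>x\<close> is in \<open>A\<close>, both decrements vanish; if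
    \<open>y\<close> is, they coincide; if \<open>x = y\<close>, the decrement after adding
    \<open>y\<close> vanishes and monotonicity suffices.\<close>
  consider "x \<in> A" | "y \<in> A" | "x = y" | "x \<in> V - A" "y \<in> V - A" "x \<noteq> y" using x y by blast
  then show "?F (A \<union> {y}) - ?F (A \<union> {x, y}) \<le> ?F A - ?F (A \<union> {x})"
  proof cases
    case 3
    then show ?thesis using trace_inverse_insert_le[OF A x] by simp
  next
    case 4
    then show ?thesis unfolding eq by (rule trace_decrement_mono[OF A])
  qed (simp_all add: insert_absorb)
qed

subsection \<open>The energy form\<close>

text \<open>Both sides are compared with the sum over ordered pairs. It counts each edge twice,
  which together with the 1/2 in the energy makes 4 times the energy.\<close>

lemma energy_eq: "gff_energy E r x = (\<Sum>i\<in>V. x i * Lap x i) / 2"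
proof -
  define f where "f = (\<lambda>(i, t). c i t * (x i - x t)\<^sup>2)"
  define P where "P = {(i, j). i < j \<and> {i, j} \<in> E}"
  have PV: "P \<subseteq> V \<times> V" using edgeD by (fastforce simp: P_def)
  have finP: "finite P" by (rule finite_subset[OF PV]) simp
  have f_swap: "f (prod.swap p) = f p" for p
    by (cases p) (simp add: f_def c_sym power2_commute)
  have f_out: "f p = 0" if "p \<notin> P \<union> prod.swap ` P" for p
  proof (cases p)
    case (Pair i t)
    have "{i, t} \<notin> E"
    proof
      assume e: "{i, t} \<in> E"
      then have "i < t \<or> t < i" using edgeD(3)[OF e] by linarith
      then show False
      proof
        assume "i < t"
        then show False using that e Pair by (simp add: P_def)
      next
        assume "t < i"
        then have "(t, i) \<in> P" using e by (simp add: P_def insert_commute)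
        then have "prod.swap (t, i) \<in> prod.swap ` P" by (rule imageI)
        then show False using that Pair by simp
      qed
    qed
    then show ?thesis using Pair by (simp add: f_def conductance_def)
  qed
  have "(\<Sum>i\<in>V. \<Sum>t\<in>V. c i t * (x i - x t)\<^sup>2) = sum f (V \<times> V)"
    by (simp add: f_def sum.cartesian_product)
  also have "\<dots> = sum f (P \<union> prod.swap ` P)"
    using PV f_out by (intro sum.mono_neutral_right) auto
  also have "\<dots> = sum f P + sum f (prod.swap ` P)"
    using finP by (intro sum.union_disjoint) (auto simp: P_def)
  also have "sum f (prod.swap ` P) = sum f P"
    by (subst sum.reindex) (simp_all add: comp_def f_swap)
  also have "sum f P = 2 * gff_energy E r x"
    unfolding gff_energy_def P_def[symmetric] sum_distrib_left
    by (intro sum.cong) (auto simp: f_def P_def conductance_def)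
  finally have 1: "(\<Sum>i\<in>V. \<Sum>t\<in>V. c i t * (x i - x t)\<^sup>2) = 4 * gff_energy E r x" by simp
  \<comment> \<open>Here \<open>(x i - x t)\<^sup>2 = x i * (x i - x t) + x t * (x t - x i)\<close>,
    and the two halves agree after exchanging \<open>i\<close> and \<open>t\<close>.\<close>
  have "(\<Sum>i\<in>V. \<Sum>t\<in>V. c i t * (x i - x t)\<^sup>2) =
      (\<Sum>i\<in>V. \<Sum>t\<in>V. x i * (c i t * (x i - x t))) + (\<Sum>i\<in>V. \<Sum>t\<in>V. x t * (c i t * (x t - x i)))"
    unfolding sum.distrib[symmetric]
    by (intro sum.cong refl) (simp add: power2_eq_square algebra_simps)
  also have "(\<Sum>i\<in>V. \<Sum>t\<in>V. x t * (c i t * (x t - x i))) = (\<Sum>i\<in>V. \<Sum>t\<in>V. x i * (c i t * (x i - x t)))"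
    by (subst sum.swap) (simp add: c_sym)
  also have "(\<Sum>i\<in>V. \<Sum>t\<in>V. x i * (c i t * (x i - x t))) = (\<Sum>i\<in>V. x i * Lap x i)"
    by (simp add: Lap_def sum_distrib_left)
  finally show ?thesis using 1 by simp
qed

text \<open>As \<open>c j j = 0\<close>, this is the diagonal entry of the Laplacian at a node
  \<open>j\<close>; for \<open>j \<noteq> 1\<close> it is also the precision of coordinate
  \<open>j\<close> given the others, see \<open>energy_slice\<close>.\<close>

definition deg :: "nat \<Rightarrow> real" where
  "deg j = (\<Sum>t\<in>V. c j t)"

lemma Lap_upd: "Lap (x(j := y)) j = Lap x j + (y - x j) * deg j"
proof -
  have "Lap (x(j := y)) j = (\<Sum>t\<in>V. c j t * (x j - x t) + (y - x j) * c j t)"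
    unfolding Lap_def by (intro sum.cong) (auto simp: algebra_simps)
  then show ?thesis by (simp add: Lap_def deg_def sum.distrib sum_distrib_left)
qed

text \<open>The exact second-order expansion of a quadratic form: in coordinate \<open>j\<close> its
  first derivative is \<open>Lap x j\<close> and its second derivative \<open>deg j\<close>.\<close>

lemma energy_upd:
  assumes j: "j \<in> V"
  shows "gff_energy E r (x(j := y)) = gff_energy E r x + (y - x j) * Lap x j + (y - x j)\<^sup>2 * deg j / 2"
proof -
  define d where "d i = (if i = j then 1 else 0 :: real)" for i
  define h where "h = y - x j"
  have upd: "x(j := y) = (\<lambda>i. x i + h * d i)" by (auto simp: d_def h_def)
  have pick: "(\<Sum>i\<in>V. d i * v i) = v j" for v
  proof -
    have "(\<Sum>i\<in>V. d i * v i) = (\<Sum>i\<in>V. if i = j then v i else 0)"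
      by (intro sum.cong) (auto simp: d_def)
    then show ?thesis using j by simp
  qed
  have L: "Lap (\<lambda>i. x i + h * d i) i = Lap x i + h * Lap d i" for i
    by (simp only: Lap_add Lap_scale)
  have dd: "Lap d j = deg j"
    unfolding Lap_def deg_def by (intro sum.cong) (auto simp: d_def)
  have "(\<Sum>i\<in>V. (x i + h * d i) * (Lap x i + h * Lap d i)) =
      (\<Sum>i\<in>V. x i * Lap x i) + h * (\<Sum>i\<in>V. x i * Lap d i)
       + h * (\<Sum>i\<in>V. d i * Lap x i) + h\<^sup>2 * (\<Sum>i\<in>V. d i * Lap d i)"
    by (simp add: algebra_simps power2_eq_square sum.distrib sum_distrib_left)
  also have "(\<Sum>i\<in>V. x i * Lap d i) = Lap x j"
    using Lap_symmetric[of x d] pick[of "Lap x"] by simp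
  finally show ?thesis
    unfolding energy_eq upd L pick dd h_def[symmetric] by (simp add: algebra_simps)
qed

lemma energy_nonneg: "0 \<le> gff_energy E r x"
  unfolding gff_energy_def using edgeD(5) by (intro sum_nonneg) (auto intro!: divide_nonneg_pos)

lemma edge_energy_le:
  assumes e: "{i, j} \<in> E"
  shows "(x i - x j)\<^sup>2 \<le> 2 * r i j * gff_energy E r x"
proof -
  define P where "P = {(i, j). i < j \<and> {i, j} \<in> E}"
  have finP: "finite P"
    by (rule finite_subset[of _ "V \<times> V"]) (use edgeD in \<open>fastforce simp: P_def\<close>, simp)
  have *: "(x a - x b)\<^sup>2 / (2 * r a b) \<le> gff_energy E r x" if "a < b" "{a, b} \<in> E" for a b
  proof -
    have "(case (a, b) of (i, j) \<Rightarrow> (x i - x j)\<^sup>2 / (2 * r i j)) \<le> gff_energy E r x"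
      unfolding gff_energy_def P_def[symmetric] using that edgeD(5)
      by (intro member_le_sum finP) (auto simp: P_def intro!: divide_nonneg_pos)
    then show ?thesis by simp
  qed
  have "(x i - x j)\<^sup>2 / (2 * r i j) \<le> gff_energy E r x"
  proof (cases "i < j")
    case True
    then show ?thesis using * e by blast
  next
    case False
    then have "j < i" using edgeD(3)[OF e] by simp
    then have "(x j - x i)\<^sup>2 / (2 * r j i) \<le> gff_energy E r x"
      using * e by (simp add: insert_commute)
    then show ?thesis by (simp add: power2_commute edgeD(4)[OF e])
  qed
  then show ?thesis using edgeD(5)[OF e] by (simp add: field_simps)
qed

text \<open>A Poincare inequality: along a path from node 1, where \<open>x\<close> vanishes, every
  edge costs at most a fixed multiple of the energy.\<close>

lemma coordinate_energy_bound:
  assumes i: "i \<in> V"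
  shows "\<exists>K\<ge>0. \<forall>x. x 1 = 0 \<longrightarrow> (x i)\<^sup>2 \<le> K * gff_energy E r x"
  using path_from_1[OF i]
proof (induction rule: rtrancl_induct)
  case base
  show ?case by (intro exI[of _ 0]) simp
next
  case (step a b)
  then have e: "{a, b} \<in> E" by simp
  obtain K where K: "0 \<le> K" "\<And>x. x 1 = 0 \<Longrightarrow> (x a)\<^sup>2 \<le> K * gff_energy E r x"
    using step.IH by blast
  \<comment> \<open>The constant comes from \<open>(x b)\<^sup>2 \<le> 2 * (x a - x b)\<^sup>2 + 2 *
    (x a)\<^sup>2\<close>, with the edge bound for the first term and the induction hypothesis for
    the second.\<close>
  have "(x b)\<^sup>2 \<le> (4 * r a b + 2 * K) * gff_energy E r x" if "x 1 = 0" for x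
  proof -
    have "0 \<le> (2 * x a - x b)\<^sup>2" by simp
    then have "(x b)\<^sup>2 \<le> 2 * (x a - x b)\<^sup>2 + 2 * (x a)\<^sup>2"
      by (simp add: power2_eq_square algebra_simps)
    also have "\<dots> \<le> 2 * (2 * r a b * gff_energy E r x) + 2 * (K * gff_energy E r x)"
      using edge_energy_le[OF e, of x] K(2)[of x] that by linarith
    finally show ?thesis by (simp add: algebra_simps)
  qed
  then show ?case
    using K(1) edgeD(5)[OF e] by (intro exI[of _ "4 * r a b + 2 * K"]) auto
qed

text \<open>Sums the coordinate bounds. This gives the density its Gaussian tails and makes
  \<open>deg j\<close> positive for \<open>j \<noteq> 1\<close>.\<close>

lemma energy_coercive:
  obtains \<epsilon> where "0 < \<epsilon>" "\<And>x. x 1 = 0 \<Longrightarrow> \<epsilon> * (\<Sum>i\<in>V. (x i)\<^sup>2) \<le> gff_energy E r x"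
proof -
  obtain K where K: "\<And>i. i \<in> V \<Longrightarrow> 0 \<le> K i"
    "\<And>i x. i \<in> V \<Longrightarrow> x 1 = 0 \<Longrightarrow> (x i)\<^sup>2 \<le> K i * gff_energy E r x"
    using coordinate_energy_bound by metis
  \<comment> \<open>The summand 1 keeps \<open>L\<close> positive even when every \<open>K i\<close>
    is 0.\<close>
  define L where "L = 1 + sum K V"
  have L: "0 < L" unfolding L_def using sum_nonneg[of V K] K(1) by fastforce
  have "(1 / L) * (\<Sum>i\<in>V. (x i)\<^sup>2) \<le> gff_energy E r x" if "x 1 = 0" for x
  proof -
    have "(\<Sum>i\<in>V. (x i)\<^sup>2) \<le> (\<Sum>i\<in>V. K i * gff_energy E r x)"
      by (intro sum_mono K(2) that)
    also have "\<dots> \<le> L * gff_energy E r x"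
      unfolding L_def sum_distrib_right[symmetric]
      using energy_nonneg[of x] by (intro mult_right_mono) simp_all
    finally show ?thesis using L by (simp add: field_simps)
  qed
  then show ?thesis using L that[of "1 / L"] by simp
qed

text \<open>Coercivity is tested on the unit vector at \<open>j\<close>, which vanishes at node 1
  because \<open>j \<noteq> 1\<close> and has energy \<open>deg j / 2\<close>.\<close>

lemma deg_pos:
  assumes j: "j \<in> V" "j \<noteq> 1"
  shows "0 < deg j"
proof -
  obtain e where e: "0 < e" "\<And>x. x 1 = 0 \<Longrightarrow> e * (\<Sum>i\<in>V. (x i)\<^sup>2) \<le> gff_energy E r x"
    using energy_coercive by blast
  define d where "d = (\<lambda>_. 0 :: real)(j := 1)"
  have "(\<Sum>i\<in>V. (d i)\<^sup>2) = (\<Sum>i\<in>V. if i = j then 1 else 0)"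
    by (intro sum.cong) (auto simp: d_def)
  also have "\<dots> = 1" using j(1) by simp
  finally have "(\<Sum>i\<in>V. (d i)\<^sup>2) = 1" .
  moreover have "gff_energy E r (\<lambda>_. 0) = 0" by (simp add: gff_energy_def)
  then have "gff_energy E r d = deg j / 2"
    unfolding d_def energy_upd[OF j(1)] Lap_zero by simp
  ultimately show ?thesis using e(1) e(2)[of d] j(2) by (simp add: d_def)
qed

subsection \<open>Integration by parts\<close>

text \<open>Completing the square in coordinate \<open>j\<close>: the slice of the density is an
  unnormalised Gaussian, and \<open>Lap\<close> at \<open>j\<close> is minus its logarithmic
  derivative.\<close>

lemma energy_slice:
  assumes j: "j \<in> V" "j \<noteq> 1"
  obtains K \<mu> \<sigma> where "0 < \<sigma>"
    "\<And>y. exp (- gff_energy E r (x(j := y))) = K * normal_density \<mu> \<sigma> y"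
    "\<And>y. Lap (x(j := y)) j = (y - \<mu>) / \<sigma>\<^sup>2"
proof -
  have a: "0 < deg j" by (rule deg_pos[OF j])
  \<comment> \<open>Expanding around the point with coordinate \<open>j\<close> at 0 leaves
    \<open>Lap x0 j\<close> as the linear coefficient, whence the mean; \<open>deg j\<close> is the
    precision, and \<open>K\<close> collects the constant left by the square and the
    normalisation.\<close>
  define x0 where "x0 = x(j := 0)"
  define \<mu> where "\<mu> = - Lap x0 j / deg j"
  define \<sigma> where "\<sigma> = 1 / sqrt (deg j)"
  define K where "K = exp (deg j * \<mu>\<^sup>2 / 2 - gff_energy E r x0) * sqrt (2 * pi * \<sigma>\<^sup>2)"
  have \<sigma>: "0 < \<sigma>" "\<sigma>\<^sup>2 = 1 / deg j" using a by (simp_all add: \<sigma>_def power_divide)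
  have b: "Lap x0 j = - (deg j * \<mu>)" using a by (simp add: \<mu>_def)
  have upd: "x(j := y) = x0(j := y)" for y by (simp add: x0_def)
  have x0j: "x0 j = 0" by (simp add: x0_def)
  have "Lap (x(j := y)) j = (y - \<mu>) / \<sigma>\<^sup>2" for y
    unfolding upd Lap_upd \<sigma>(2) b by (simp add: x0j algebra_simps)
  moreover have "exp (- gff_energy E r (x(j := y))) = K * normal_density \<mu> \<sigma> y" for y
  proof -
    have "- gff_energy E r (x(j := y)) =
        (deg j * \<mu>\<^sup>2 / 2 - gff_energy E r x0) + (- (y - \<mu>)\<^sup>2 / (2 * \<sigma>\<^sup>2))"
      unfolding upd energy_upd[OF j(1)] \<sigma>(2) b x0j by (simp add: power2_eq_square field_simps)
    then have "exp (- gff_energy E r (x(j := y))) =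
        exp (deg j * \<mu>\<^sup>2 / 2 - gff_energy E r x0) * exp (- (y - \<mu>)\<^sup>2 / (2 * \<sigma>\<^sup>2))"
      by (simp only: exp_add)
    moreover have "sqrt (2 * pi * \<sigma>\<^sup>2) \<noteq> 0" using \<sigma>(1) by simp
    ultimately show ?thesis unfolding K_def normal_density_def by simp
  qed
  ultimately show ?thesis using \<sigma>(1) that by blast
qed

text \<open>Gaussian integration by parts in one variable, read off from the first two centred
  moments of the normal density.\<close>

lemma slice_stein:
  assumes j: "j \<in> V" "j \<noteq> 1"
  shows "(\<integral>y. exp (- gff_energy E r (x(j := y))) * Lap (x(j := y)) j \<partial>lborel) = 0"
    and "(\<integral>y. exp (- gff_energy E r (x(j := y))) * (Lap (x(j := y)) j * y) \<partial>lborel) =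
      (\<integral>y. exp (- gff_energy E r (x(j := y))) \<partial>lborel)"
proof -
  obtain K \<mu> \<sigma> where \<sigma>: "0 < \<sigma>"
    and E: "\<And>y. exp (- gff_energy E r (x(j := y))) = K * normal_density \<mu> \<sigma> y"
    and L: "\<And>y. Lap (x(j := y)) j = (y - \<mu>) / \<sigma>\<^sup>2"
    by (rule energy_slice[OF j, of x]) (rule that)
  have m1: "has_bochner_integral lborel (\<lambda>y. normal_density \<mu> \<sigma> y * (y - \<mu>)) 0"
    using normal_moment_odd[OF \<sigma>, of \<mu> 0] by simp
  have m2: "has_bochner_integral lborel (\<lambda>y. normal_density \<mu> \<sigma> y * (y - \<mu>)\<^sup>2) (\<sigma>\<^sup>2)"
    using normal_moment_even[OF \<sigma>, of \<mu> 1] by (simp add: fact_numeral)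
  have i1: "has_bochner_integral lborel (\<lambda>y. (K / \<sigma>\<^sup>2) * (normal_density \<mu> \<sigma> y * (y - \<mu>))) ((K / \<sigma>\<^sup>2) * 0)"
    by (rule has_bochner_integral_mult_right) (rule m1)
  have e1: "(\<lambda>y. (K / \<sigma>\<^sup>2) * (normal_density \<mu> \<sigma> y * (y - \<mu>))) =
      (\<lambda>y. K * normal_density \<mu> \<sigma> y * ((y - \<mu>) / \<sigma>\<^sup>2))"
    by (intro ext) simp
  have "(\<integral>y. K * normal_density \<mu> \<sigma> y * ((y - \<mu>) / \<sigma>\<^sup>2) \<partial>lborel) = (K / \<sigma>\<^sup>2) * 0"
    by (rule has_bochner_integral_integral_eq[OF i1[unfolded e1]])
  then show "(\<integral>y. exp (- gff_energy E r (x(j := y))) * Lap (x(j := y)) j \<partial>lborel) = 0"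
    unfolding E L mult_zero_right .
  \<comment> \<open>The factor \<open>y\<close> is split as \<open>(y - \<mu>) + \<mu>\<close>, so
    that only centred moments occur.\<close>
  have i2: "has_bochner_integral lborel
      (\<lambda>y. (K / \<sigma>\<^sup>2) * (normal_density \<mu> \<sigma> y * (y - \<mu>)\<^sup>2 + \<mu> * (normal_density \<mu> \<sigma> y * (y - \<mu>))))
      ((K / \<sigma>\<^sup>2) * (\<sigma>\<^sup>2 + \<mu> * 0))"
    by (intro has_bochner_integral_mult_right has_bochner_integral_add m1 m2)
  have e2: "(\<lambda>y. (K / \<sigma>\<^sup>2) * (normal_density \<mu> \<sigma> y * (y - \<mu>)\<^sup>2 + \<mu> * (normal_density \<mu> \<sigma> y * (y - \<mu>)))) =
      (\<lambda>y. K * normal_density \<mu> \<sigma> y * ((y - \<mu>) / \<sigma>\<^sup>2 * y))"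
    by (intro ext) (simp add: power2_eq_square field_simps)
  have "(\<integral>y. K * normal_density \<mu> \<sigma> y * ((y - \<mu>) / \<sigma>\<^sup>2 * y) \<partial>lborel) =
      (K / \<sigma>\<^sup>2) * (\<sigma>\<^sup>2 + \<mu> * 0)"
    by (rule has_bochner_integral_integral_eq[OF i2[unfolded e2]])
  then show "(\<integral>y. exp (- gff_energy E r (x(j := y))) * (Lap (x(j := y)) j * y) \<partial>lborel) =
      (\<integral>y. exp (- gff_energy E r (x(j := y))) \<partial>lborel)"
    unfolding E L using \<sigma> by simp
qed

abbreviation "N \<equiv> \<Pi>\<^sub>M i\<in>{2..n}. (lborel :: real measure)"
text \<open>Points of \<open>N\<close> have no coordinate for node 1; \<open>pin\<close> supplies
  the boundary value there.\<close>

abbreviation "pin x \<equiv> (x :: nat \<Rightarrow> real)(1 := 0)"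
abbreviation "weight x \<equiv> exp (- gff_energy E r (pin x))"

lemma pin_measurable [measurable]: "i \<in> V \<Longrightarrow> (\<lambda>x. pin x i) \<in> borel_measurable N"
  by (cases "i = 1") auto

lemma Lap_pin_measurable [measurable]: "i \<in> V \<Longrightarrow> (\<lambda>x. Lap (pin x) i) \<in> borel_measurable N"
  unfolding Lap_def
  by (intro borel_measurable_sum borel_measurable_times borel_measurable_diff pin_measurable) auto

lemma weight_measurable [measurable]: "weight \<in> borel_measurable N"
proof -
  have "(\<lambda>x. (\<Sum>i\<in>V. pin x i * Lap (pin x) i) / 2) \<in> borel_measurable N"
    by (intro borel_measurable_divide borel_measurable_sum borel_measurable_times
        pin_measurable Lap_pin_measurable borel_measurable_const)
  then show ?thesis unfolding energy_eq by measurable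
qed

lemma nodes_insert: "j \<in> {2..n} \<Longrightarrow> {2..n} = insert j ({2..n} - {j})"
  by auto

lemma pin_upd: "j \<in> {2..n} \<Longrightarrow> pin (x(j := y)) = (pin x)(j := y)"
  by (auto simp: fun_upd_twist)

text \<open>Fubini's theorem, isolating the coordinate in which the integration by parts takes
  place.\<close>

lemma integral_slices:
  fixes f :: "(nat \<Rightarrow> real) \<Rightarrow> real"
  assumes j: "j \<in> {2..n}" and f: "integrable N f"
  shows "integral\<^sup>L N f = (\<integral>x. (\<integral>y. f (x(j := y)) \<partial>lborel) \<partial>(\<Pi>\<^sub>M i\<in>{2..n} - {j}. lborel))"
proof -
  interpret product_sigma_finite "\<lambda>_::nat. lborel :: real measure" ..
  have "integrable (Pi\<^sub>M (insert j ({2..n} - {j})) (\<lambda>_. lborel)) f"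
    using f nodes_insert[OF j] by simp
  from product_integral_insert[OF _ _ this] show ?thesis
    using nodes_insert[OF j] by simp
qed

text \<open>As \<open>g\<close> is constant in coordinate \<open>j\<close>, it leaves the inner
  integral, and \<open>slice_stein\<close> evaluates every slice. The integrability premises are
  what Fubini requires.\<close>

lemma stein:
  fixes g :: "(nat \<Rightarrow> real) \<Rightarrow> real"
  assumes j: "j \<in> {2..n}" and g: "\<And>x y. g (x(j := y)) = g x"
  shows "integrable N (\<lambda>x. weight x * (g x * Lap (pin x) j)) \<Longrightarrow>
      (\<integral>x. weight x * (g x * Lap (pin x) j) \<partial>N) = 0"
    and "integrable N (\<lambda>x. weight x * (g x * (x j * Lap (pin x) j))) \<Longrightarrow>
      integrable N (\<lambda>x. weight x * g x) \<Longrightarrow>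
      (\<integral>x. weight x * (g x * (x j * Lap (pin x) j)) \<partial>N) = (\<integral>x. weight x * g x \<partial>N)"
proof -
  have jV: "j \<in> V" "j \<noteq> 1" using j by auto
  have s1: "(\<integral>y. weight (x(j := y)) * (g (x(j := y)) * Lap (pin (x(j := y))) j) \<partial>lborel) = 0" for x
  proof -
    have "(\<lambda>y. weight (x(j := y)) * (g (x(j := y)) * Lap (pin (x(j := y))) j)) =
        (\<lambda>y. g x * (exp (- gff_energy E r ((pin x)(j := y))) * Lap ((pin x)(j := y)) j))"
      unfolding g pin_upd[OF j] by (simp only: ac_simps)
    then show ?thesis using slice_stein(1)[OF jV, of "pin x"] by simp
  qed
  show "(\<integral>x. weight x * (g x * Lap (pin x) j) \<partial>N) = 0"
    if "integrable N (\<lambda>x. weight x * (g x * Lap (pin x) j))"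
    unfolding integral_slices[OF j that] s1 by simp
  have s2: "(\<integral>y. weight (x(j := y)) * (g (x(j := y)) * ((x(j := y)) j * Lap (pin (x(j := y))) j)) \<partial>lborel) =
      (\<integral>y. weight (x(j := y)) * g (x(j := y)) \<partial>lborel)" for x
  proof -
    have 1: "(\<lambda>y. weight (x(j := y)) * (g (x(j := y)) * ((x(j := y)) j * Lap (pin (x(j := y))) j))) =
        (\<lambda>y. g x * (exp (- gff_energy E r ((pin x)(j := y))) * (Lap ((pin x)(j := y)) j * y)))"
      unfolding g pin_upd[OF j] fun_upd_same by (simp only: ac_simps)
    have 2: "(\<lambda>y. weight (x(j := y)) * g (x(j := y))) =
        (\<lambda>y. g x * exp (- gff_energy E r ((pin x)(j := y))))"
      unfolding g pin_upd[OF j] by (simp only: ac_simps)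
    show ?thesis unfolding 1 2 integral_mult_right_zero slice_stein(2)[OF jV, of "pin x"] ..
  qed
  show "(\<integral>x. weight x * (g x * (x j * Lap (pin x) j)) \<partial>N) = (\<integral>x. weight x * g x \<partial>N)"
    if "integrable N (\<lambda>x. weight x * (g x * (x j * Lap (pin x) j)))" "integrable N (\<lambda>x. weight x * g x)"
    unfolding integral_slices[OF j that(1)] integral_slices[OF j that(2)] s2 ..
qed

text \<open>By coercivity the weight is dominated by a product of one-dimensional Gaussians, with
  the extra square put into factor \<open>k\<close>.\<close>

lemma weight_square_integrable:
  assumes k: "k \<in> {2..n}"
  shows "integrable N (\<lambda>x. weight x * (x k)\<^sup>2)"
proof -
  obtain e where e: "0 < e" "\<And>x. x 1 = 0 \<Longrightarrow> e * (\<Sum>i\<in>V. (x i)\<^sup>2) \<le> gff_energy E r x"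
    using energy_coercive by blast
  \<comment> \<open>This choice turns \<open>exp (- e * y\<^sup>2)\<close> into a multiple of a
    centred normal density, whose moments are integrable.\<close>
  define \<sigma> where "\<sigma> = 1 / sqrt (2 * e)"
  have \<sigma>: "0 < \<sigma>" "\<sigma>\<^sup>2 = 1 / (2 * e)" using e(1) by (simp_all add: \<sigma>_def power_divide)
  define f where "f i y = (if i = k then exp (- e * y\<^sup>2) * y\<^sup>2 else exp (- e * y\<^sup>2))" for i :: nat and y :: real
  have nd: "exp (- e * y\<^sup>2) = sqrt (2 * pi * \<sigma>\<^sup>2) * normal_density 0 \<sigma> y" for y
    using e(1) unfolding normal_density_def \<sigma>(2) by simp
  interpret product_sigma_finite "\<lambda>_::nat. lborel :: real measure" ..
  have f_int: "integrable lborel (f i)" for i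
    using integrable_normal_moment[OF \<sigma>(1), of 0 2]
    unfolding f_def nd using \<sigma>(1) by (cases "i = k") (simp_all add: mult.assoc)
  have "integrable N (\<lambda>x. \<Prod>i\<in>{2..n}. f i (x i))"
    by (rule product_integrable_prod) (simp_all add: f_int)
  then show ?thesis
  proof (rule Bochner_Integration.integrable_bound)
    show "(\<lambda>x. weight x * (x k)\<^sup>2) \<in> borel_measurable N"
      using k by measurable
    have "weight x * (x k)\<^sup>2 \<le> (\<Prod>i\<in>{2..n}. f i (x i))" for x
    proof -
      have "(\<Sum>i\<in>V. (pin x i)\<^sup>2) = (\<Sum>i\<in>{2..n}. (x i)\<^sup>2)"
      proof -
        have "(\<Sum>i\<in>{2..n}. (pin x i)\<^sup>2) = (\<Sum>i\<in>V. (pin x i)\<^sup>2)"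
          by (rule sum.mono_neutral_left) (auto simp: not_less_eq_eq)
        moreover have "(\<Sum>i\<in>{2..n}. (pin x i)\<^sup>2) = (\<Sum>i\<in>{2..n}. (x i)\<^sup>2)"
          by (intro sum.cong) auto
        ultimately show ?thesis by simp
      qed
      then have "weight x \<le> exp (\<Sum>i\<in>{2..n}. - e * (x i)\<^sup>2)"
        using e(2)[of "pin x"] by (simp add: sum_distrib_left sum_negf)
      also have "\<dots> = (\<Prod>i\<in>{2..n}. exp (- e * (x i)\<^sup>2))" by (rule exp_sum) simp
      finally have "weight x * (x k)\<^sup>2 \<le> (\<Prod>i\<in>{2..n}. exp (- e * (x i)\<^sup>2)) * (x k)\<^sup>2"
        by (rule mult_right_mono) simp
      also have "\<dots> = (\<Prod>i\<in>{2..n}. exp (- e * (x i)\<^sup>2)) * (\<Prod>i\<in>{2..n}. if i = k then (x k)\<^sup>2 else 1)"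
        using k by simp
      also have "\<dots> = (\<Prod>i\<in>{2..n}. f i (x i))"
        unfolding prod.distrib[symmetric] by (intro prod.cong) (auto simp: f_def)
      finally show ?thesis .
    qed
    moreover have "0 \<le> (\<Prod>i\<in>{2..n}. f i (x i))" for x
      by (intro prod_nonneg) (auto simp: f_def)
    ultimately show "AE x in N. norm (weight x * (x k)\<^sup>2) \<le> norm (\<Prod>i\<in>{2..n}. f i (x i))"
      by simp
  qed
qed

end

section \<open>The law of the field and its moments\<close>

locale gff_network = weighted_network n E r
  for n :: nat and E :: "nat set set" and r :: "nat \<Rightarrow> nat \<Rightarrow> real" +
  fixes M :: "'a measure" and X :: "nat \<Rightarrow> 'a \<Rightarrow> real"
  assumes gff: "gaussian_free_field n E r M X"

sublocale gff_network \<subseteq> prob_space M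
  using gff unfolding gaussian_free_field_def by blast

context gff_network
begin

definition W :: "'a \<Rightarrow> nat \<Rightarrow> real" where
  "W \<omega> = (\<lambda>i\<in>{2..n}. X i \<omega>)"

abbreviation "LX \<omega> j \<equiv> Lap (\<lambda>i. X i \<omega>) j"

lemma pin_W: "\<omega> \<in> space M \<Longrightarrow> i \<in> V \<Longrightarrow> pin (W \<omega>) i = X i \<omega>"
  using gff by (auto simp: gaussian_free_field_def W_def)

lemma Lap_pin_W: "\<omega> \<in> space M \<Longrightarrow> j \<in> V \<Longrightarrow> Lap (pin (W \<omega>)) j = LX \<omega> j"
  by (intro Lap_cong pin_W)

text \<open>Since \<open>ennreal\<close> sends negative numbers to 0, the constant may be replaced
  by its positive part; that is nonzero because the density has total mass 1.\<close>

lemma W_distributed: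
  obtains a where "0 < a" "distributed M N W (\<lambda>x. ennreal (a * weight x))"
proof -
  obtain b where b: "distributed M N W (\<lambda>x. ennreal (b * weight x))"
    using gff unfolding gaussian_free_field_def W_def by blast
  have "(\<lambda>x. ennreal (b * weight x)) = (\<lambda>x. ennreal (max 0 b * weight x))"
    by (cases "0 \<le> b") (auto simp: max_def ennreal_neg mult_nonpos_nonneg)
  then have D: "distributed M N W (\<lambda>x. ennreal (max 0 b * weight x))" using b by simp
  have "max 0 b \<noteq> 0"
  proof
    assume "max 0 b = 0"
    then show False
      using distributed_integral[OF D, of "\<lambda>_. 1"] by (simp add: prob_space)
  qed
  then show ?thesis using that[of "max 0 b"] D by simp
qed

lemma W_measurable [measurable]: "W \<in> measurable M N"
  using W_distributed distributed_measurable by metis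

lemma X_measurable [measurable]: "i \<in> V \<Longrightarrow> X i \<in> borel_measurable M"
proof -
  assume i: "i \<in> V"
  have "(\<lambda>\<omega>. pin (W \<omega>) i) \<in> borel_measurable M"
    using measurable_comp[OF W_measurable pin_measurable[OF i]] by (simp add: comp_def)
  then show ?thesis
    using pin_W[OF _ i] by (subst (asm) measurable_cong) auto
qed

lemma integrable_transfer:
  assumes g: "g \<in> borel_measurable N"
  shows "integrable N (\<lambda>x. weight x * g x) \<longleftrightarrow> integrable M (\<lambda>\<omega>. g (W \<omega>))"
proof -
  obtain a where a: "0 < a" and D: "distributed M N W (\<lambda>x. ennreal (a * weight x))"
    using W_distributed by blast
  have "integrable N (\<lambda>x. a * weight x * g x) \<longleftrightarrow> integrable M (\<lambda>\<omega>. g (W \<omega>))"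
    using a by (intro distributed_integrable[OF D g]) simp
  then show ?thesis using a by (simp add: mult.assoc)
qed

text \<open>Transfers \<open>stein\<close> through the density of \<open>W\<close>. The pinned
  \<open>W\<close> agrees with \<open>X\<close> at the nodes for points of \<open>space M\<close>,
  so the integrands are matched by congruence there.\<close>

lemma expectation_stein:
  fixes g :: "(nat \<Rightarrow> real) \<Rightarrow> real"
  assumes j: "j \<in> {2..n}" and g: "g \<in> borel_measurable N" "\<And>x y. g (x(j := y)) = g x"
  shows "integrable M (\<lambda>\<omega>. g (W \<omega>) * LX \<omega> j) \<Longrightarrow> expectation (\<lambda>\<omega>. g (W \<omega>) * LX \<omega> j) = 0"
    and "integrable M (\<lambda>\<omega>. g (W \<omega>) * (X j \<omega> * LX \<omega> j)) \<Longrightarrow> integrable M (\<lambda>\<omega>. g (W \<omega>)) \<Longrightarrow>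
      expectation (\<lambda>\<omega>. g (W \<omega>) * (X j \<omega> * LX \<omega> j)) = expectation (\<lambda>\<omega>. g (W \<omega>))"
proof -
  obtain a where a: "0 < a" and D: "distributed M N W (\<lambda>x. ennreal (a * weight x))"
    using W_distributed by blast
  have jV: "j \<in> V" using j by auto
  have int: "a * (\<integral>x. weight x * f x \<partial>N) = expectation (\<lambda>\<omega>. f (W \<omega>))"
    if "f \<in> borel_measurable N" for f :: "(nat \<Rightarrow> real) \<Rightarrow> real"
    using distributed_integral[OF D that] a by (simp add: mult.assoc)
  have Wj: "W \<omega> j = X j \<omega>" for \<omega> using j by (simp add: W_def)
  have m1: "(\<lambda>x. g x * Lap (pin x) j) \<in> borel_measurable N"
    by (intro borel_measurable_times g(1) Lap_pin_measurable jV)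
  have m2: "(\<lambda>x. g x * (x j * Lap (pin x) j)) \<in> borel_measurable N"
    using j by (intro borel_measurable_times g(1) Lap_pin_measurable jV) simp
  show "expectation (\<lambda>\<omega>. g (W \<omega>) * LX \<omega> j) = 0" if i: "integrable M (\<lambda>\<omega>. g (W \<omega>) * LX \<omega> j)"
  proof -
    have "integrable M (\<lambda>\<omega>. g (W \<omega>) * Lap (pin (W \<omega>)) j)"
      using i by (rule Bochner_Integration.integrable_cong[THEN iffD1, rotated 2]) (simp_all only: Lap_pin_W[OF _ jV])
    then have 1: "integrable N (\<lambda>x. weight x * (g x * Lap (pin x) j))"
      by (simp only: integrable_transfer[OF m1])
    have "expectation (\<lambda>\<omega>. g (W \<omega>) * Lap (pin (W \<omega>)) j) = 0"
      unfolding int[OF m1, symmetric] stein(1)[of j g, OF j g(2) 1] by simp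
    moreover have "expectation (\<lambda>\<omega>. g (W \<omega>) * Lap (pin (W \<omega>)) j) = expectation (\<lambda>\<omega>. g (W \<omega>) * LX \<omega> j)"
      by (rule Bochner_Integration.integral_cong) (simp_all only: Lap_pin_W[OF _ jV])
    ultimately show ?thesis by simp
  qed
  show "expectation (\<lambda>\<omega>. g (W \<omega>) * (X j \<omega> * LX \<omega> j)) = expectation (\<lambda>\<omega>. g (W \<omega>))"
    if i: "integrable M (\<lambda>\<omega>. g (W \<omega>) * (X j \<omega> * LX \<omega> j))" "integrable M (\<lambda>\<omega>. g (W \<omega>))"
  proof -
    have "integrable M (\<lambda>\<omega>. g (W \<omega>) * (W \<omega> j * Lap (pin (W \<omega>)) j))"
      using i(1) by (rule Bochner_Integration.integrable_cong[THEN iffD1, rotated 2]) (simp_all only: Lap_pin_W[OF _ jV] Wj)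
    then have 1: "integrable N (\<lambda>x. weight x * (g x * (x j * Lap (pin x) j)))"
      by (simp only: integrable_transfer[OF m2])
    have 2: "integrable N (\<lambda>x. weight x * g x)"
      using i(2) by (simp only: integrable_transfer[OF g(1)])
    have "expectation (\<lambda>\<omega>. g (W \<omega>) * (W \<omega> j * Lap (pin (W \<omega>)) j)) = expectation (\<lambda>\<omega>. g (W \<omega>))"
      unfolding int[OF m2, symmetric] int[OF g(1), symmetric] stein(2)[of j g, OF j g(2) 1 2] ..
    moreover have "expectation (\<lambda>\<omega>. g (W \<omega>) * (W \<omega> j * Lap (pin (W \<omega>)) j)) =
        expectation (\<lambda>\<omega>. g (W \<omega>) * (X j \<omega> * LX \<omega> j))"
      by (rule Bochner_Integration.integral_cong) (simp_all only: Lap_pin_W[OF _ jV] Wj)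
    ultimately show ?thesis by simp
  qed
qed

lemma X_square_integrable: "i \<in> V \<Longrightarrow> integrable M (\<lambda>\<omega>. (X i \<omega>)\<^sup>2)"
proof -
  assume i: "i \<in> V"
  show ?thesis
  \<comment> \<open>Node 1 is not a coordinate of \<open>N\<close>, but \<open>X 1\<close> vanishes
    on \<open>space M\<close>.\<close>
  proof (cases "i = 1")
    case True
    have "integrable M (\<lambda>\<omega>. 0 :: real)" by simp
    then show ?thesis
      by (rule Bochner_Integration.integrable_cong[THEN iffD1, rotated 2])
        (use gff True in \<open>simp_all add: gaussian_free_field_def\<close>)
  next
    case False
    then have i2: "i \<in> {2..n}" using i by auto
    have "(\<lambda>x. (x i)\<^sup>2) \<in> borel_measurable N" using i2 by measurable
    from integrable_transfer[OF this] weight_square_integrable[OF i2]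
    show ?thesis using i2 by (simp add: W_def)
  qed
qed

lemma X_mult_integrable:
  assumes "i \<in> V" "j \<in> V"
  shows "integrable M (\<lambda>\<omega>. X i \<omega> * X j \<omega>)"
proof (rule Bochner_Integration.integrable_bound)
  show "integrable M (\<lambda>\<omega>. (X i \<omega>)\<^sup>2 + (X j \<omega>)\<^sup>2)"
    using assms by (intro Bochner_Integration.integrable_add X_square_integrable)
  show "(\<lambda>\<omega>. X i \<omega> * X j \<omega>) \<in> borel_measurable M"
    using assms by measurable
  have "\<bar>a * b\<bar> \<le> a\<^sup>2 + b\<^sup>2" for a b :: real
    using sum_squares_bound[of "\<bar>a\<bar>" "\<bar>b\<bar>"] mult_nonneg_nonneg[OF abs_ge_zero[of a] abs_ge_zero[of b]]
    unfolding abs_mult power2_abs by linarith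
  then show "AE \<omega> in M. norm (X i \<omega> * X j \<omega>) \<le> norm ((X i \<omega>)\<^sup>2 + (X j \<omega>)\<^sup>2)"
    by simp
qed

lemma X_integrable: "i \<in> V \<Longrightarrow> integrable M (X i)"
  by (rule square_integrable_imp_integrable[OF X_measurable X_square_integrable])

lemma LX_integrable: "j \<in> V \<Longrightarrow> integrable M (\<lambda>\<omega>. LX \<omega> j)"
  unfolding Lap_def
  by (intro Bochner_Integration.integrable_sum integrable_mult_right Bochner_Integration.integrable_diff X_integrable)

lemma X_LX_integrable:
  assumes "i \<in> V" "j \<in> V"
  shows "integrable M (\<lambda>\<omega>. X i \<omega> * LX \<omega> j)"
proof -
  have "(\<lambda>\<omega>. X i \<omega> * LX \<omega> j) = (\<lambda>\<omega>. \<Sum>t\<in>V. c j t * (X i \<omega> * X j \<omega> - X i \<omega> * X t \<omega>))"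
    unfolding Lap_def sum_distrib_left by (intro ext sum.cong refl) (simp add: algebra_simps)
  then show ?thesis
    using assms
    by (simp only:) (intro Bochner_Integration.integrable_sum integrable_mult_right
        Bochner_Integration.integrable_diff X_mult_integrable)
qed

subsection \<open>Conditioning on the observed nodes\<close>

lemma observed_map: "(\<lambda>\<omega>. \<lambda>i\<in>S. X i \<omega>) \<in> space M \<rightarrow> space (\<Pi>\<^sub>M i\<in>S. borel)"
  by (auto simp: space_PiM)

lemma observed_measurable: "i \<in> S \<Longrightarrow> X i \<in> borel_measurable (observed M X S)"
proof -
  assume i: "i \<in> S"
  have "(\<lambda>\<omega>. \<lambda>i\<in>S. X i \<omega>) \<in> measurable (observed M X S) (\<Pi>\<^sub>M i\<in>S. borel)"
    unfolding observed_def by (rule measurable_vimage_algebra1[OF observed_map])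
  from measurable_comp[OF this measurable_component_singleton[OF i]] show ?thesis
    using i by (simp add: comp_def)
qed

lemma subalgebra_observed:
  assumes S: "S \<subseteq> V"
  shows "subalgebra M (observed M X S)"
proof -
  have m: "(\<lambda>\<omega>. \<lambda>i\<in>S. X i \<omega>) \<in> measurable M (\<Pi>\<^sub>M i\<in>S. borel)"
    using S by (intro measurable_restrict X_measurable) auto
  show ?thesis
    unfolding subalgebra_def observed_def sets_vimage_algebra2[OF observed_map]
    using measurable_sets[OF m] by auto
qed

text \<open>Observed events are preimages under the coordinates in \<open>S\<close>, so their
  indicators are functions of \<open>W\<close> blind to all other coordinates: suitable test
  functions for \<open>expectation_stein\<close>.\<close>

lemma observed_indicator:
  assumes S: "S \<in> observation_sets n" and A: "A \<in> sets (observed M X S)"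
  obtains g :: "(nat \<Rightarrow> real) \<Rightarrow> real" where "g \<in> borel_measurable N"
    "\<And>\<omega>. \<omega> \<in> space M \<Longrightarrow> g (W \<omega>) = indicator A \<omega>" "\<And>j x y. j \<notin> S \<Longrightarrow> g (x(j := y)) = g x"
proof -
  have S': "S \<subseteq> V" "1 \<in> S" using S by (auto simp: observation_sets_def)
  obtain B where B: "B \<in> sets (\<Pi>\<^sub>M i\<in>S. borel)" and A_eq: "A = (\<lambda>\<omega>. \<lambda>i\<in>S. X i \<omega>) -` B \<inter> space M"
    using A unfolding observed_def sets_vimage_algebra2[OF observed_map] by blast
  \<comment> \<open>Node 1 lies in \<open>S\<close> but is missing from \<open>W\<close>, hence
    \<open>pin\<close>.\<close>
  define g where "g = (indicator B :: _ \<Rightarrow> real) \<circ> (\<lambda>x. \<lambda>i\<in>S. pin x i)"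
  have "(\<lambda>x. \<lambda>i\<in>S. pin x i) \<in> measurable N (\<Pi>\<^sub>M i\<in>S. borel)"
    using S' by (intro measurable_restrict pin_measurable) auto
  from measurable_comp[OF this borel_measurable_indicator[OF B]]
  have "g \<in> borel_measurable N" unfolding g_def .
  moreover have "g (W \<omega>) = indicator A \<omega>" if w: "\<omega> \<in> space M" for \<omega>
  proof -
    have e: "(\<lambda>i\<in>S. pin (W \<omega>) i) = (\<lambda>i\<in>S. X i \<omega>)"
      by (intro restrict_ext pin_W[OF w] subsetD[OF S'(1)])
    show ?thesis unfolding g_def A_eq comp_def e using w by (simp add: indicator_def)
  qed
  moreover have "g (x(j := y)) = g x" if "j \<notin> S" for j x y
  proof -
    have e: "(\<lambda>i\<in>S. pin (x(j := y)) i) = (\<lambda>i\<in>S. pin x i)"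
      using that by (intro restrict_ext) auto
    show ?thesis unfolding g_def comp_def e ..
  qed
  ultimately show ?thesis using that by blast
qed

text \<open>Integration by parts with an observed event as test function. For \<open>k = j\<close>
  the second Stein identity applies; for \<open>k \<noteq> j\<close> the product of the indicator
  with \<open>X k\<close> is again free of coordinate \<open>j\<close>, so the first one
  does.\<close>

lemma laplacian_moments:
  assumes S: "S \<in> observation_sets n" and A: "A \<in> sets (observed M X S)" and j: "j \<in> V - S"
  shows "expectation (\<lambda>\<omega>. indicator A \<omega> * LX \<omega> j) = 0"
    and "k \<in> V \<Longrightarrow> expectation (\<lambda>\<omega>. indicator A \<omega> * (X k \<omega> * LX \<omega> j)) = (if k = j then prob A else 0)"
proof -
  have S': "S \<subseteq> V" "1 \<in> S" using S by (auto simp: observation_sets_def)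
  have AM: "A \<in> sets M" using subalgebra_observed[OF S'(1)] A by (auto simp: subalgebra_def)
  have "j \<noteq> 1" using j S'(2) by blast
  then have j2: "j \<in> {2..n}" "j \<in> V" "j \<notin> S" using j by auto
  obtain g :: "(nat \<Rightarrow> real) \<Rightarrow> real" where g: "g \<in> borel_measurable N"
    "\<And>\<omega>. \<omega> \<in> space M \<Longrightarrow> g (W \<omega>) = indicator A \<omega>" "\<And>j x y. j \<notin> S \<Longrightarrow> g (x(j := y)) = g x"
    by (rule observed_indicator[OF S A]) (rule that)
  have int: "integrable M (\<lambda>\<omega>. indicator A \<omega> * f \<omega>)" if "integrable M f" for f :: "'a \<Rightarrow> real"
    using integrable_mult_indicator[OF AM that] by simp
  \<comment> \<open>Used with \<open>f\<close> equal to 1 and to \<open>X k\<close>.\<close>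
  have E0: "expectation (\<lambda>\<omega>. h (W \<omega>) * LX \<omega> j) = 0"
    if h: "h \<in> borel_measurable N" "\<And>x y. h (x(j := y)) = h x"
      and f: "\<And>\<omega>. \<omega> \<in> space M \<Longrightarrow> h (W \<omega>) = indicator A \<omega> * f \<omega>" "integrable M (\<lambda>\<omega>. f \<omega> * LX \<omega> j)"
    for h f
  proof (rule expectation_stein(1)[OF j2(1) h])
    show "integrable M (\<lambda>\<omega>. h (W \<omega>) * LX \<omega> j)"
      using int[OF f(2)]
      by (rule Bochner_Integration.integrable_cong[THEN iffD1, rotated 2]) (simp_all add: f(1))
  qed
  have "expectation (\<lambda>\<omega>. g (W \<omega>) * LX \<omega> j) = 0"
    using LX_integrable[OF j2(2)] by (intro E0[of g "\<lambda>_. 1"]) (simp_all add: g j2)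
  moreover have "expectation (\<lambda>\<omega>. g (W \<omega>) * LX \<omega> j) = expectation (\<lambda>\<omega>. indicator A \<omega> * LX \<omega> j)"
    by (rule Bochner_Integration.integral_cong) (simp_all add: g(2))
  ultimately show "expectation (\<lambda>\<omega>. indicator A \<omega> * LX \<omega> j) = 0" by simp
  assume k: "k \<in> V"
  show "expectation (\<lambda>\<omega>. indicator A \<omega> * (X k \<omega> * LX \<omega> j)) = (if k = j then prob A else 0)"
  proof (cases "k = j")
    case True
    have "expectation (\<lambda>\<omega>. g (W \<omega>) * (X j \<omega> * LX \<omega> j)) = expectation (\<lambda>\<omega>. g (W \<omega>))"
    proof (rule expectation_stein(2)[OF j2(1) g(1) g(3)[OF j2(3)]])
      show "integrable M (\<lambda>\<omega>. g (W \<omega>) * (X j \<omega> * LX \<omega> j))"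
        using int[OF X_LX_integrable[OF j2(2) j2(2)]]
        by (rule Bochner_Integration.integrable_cong[THEN iffD1, rotated 2]) (simp_all add: g(2))
      have "integrable M (\<lambda>\<omega>. indicator A \<omega> * (1 :: real))" by (rule int) simp
      then show "integrable M (\<lambda>\<omega>. g (W \<omega>))"
        by (rule Bochner_Integration.integrable_cong[THEN iffD1, rotated 2]) (simp_all add: g(2))
    qed
    moreover have "expectation (\<lambda>\<omega>. g (W \<omega>)) = expectation (indicator A)"
      by (rule Bochner_Integration.integral_cong) (simp_all add: g(2))
    moreover have "expectation (indicator A) = prob A" using AM by simp
    moreover have "expectation (\<lambda>\<omega>. g (W \<omega>) * (X j \<omega> * LX \<omega> j)) =
        expectation (\<lambda>\<omega>. indicator A \<omega> * (X j \<omega> * LX \<omega> j))"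
      by (rule Bochner_Integration.integral_cong) (simp_all add: g(2))
    ultimately show ?thesis using True by simp
  next
    case False
    have "expectation (\<lambda>\<omega>. (g (W \<omega>) * pin (W \<omega>) k) * LX \<omega> j) = 0"
    proof (rule E0[of "\<lambda>x. g x * pin x k" "X k"])
      show "(\<lambda>x. g x * pin x k) \<in> borel_measurable N"
        by (intro borel_measurable_times g(1) pin_measurable k)
      show "g (x(j := y)) * pin (x(j := y)) k = g x * pin x k" for x y
        using False by (simp add: g(3)[OF j2(3)])
      show "g (W \<omega>) * pin (W \<omega>) k = indicator A \<omega> * X k \<omega>" if "\<omega> \<in> space M" for \<omega>
        unfolding g(2)[OF that] pin_W[OF that k] ..
      show "integrable M (\<lambda>\<omega>. X k \<omega> * LX \<omega> j)" by (rule X_LX_integrable[OF k j2(2)])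
    qed
    moreover have "expectation (\<lambda>\<omega>. (g (W \<omega>) * pin (W \<omega>) k) * LX \<omega> j) =
        expectation (\<lambda>\<omega>. indicator A \<omega> * (X k \<omega> * LX \<omega> j))"
    proof (rule Bochner_Integration.integral_cong[OF refl])
      fix \<omega> assume "\<omega> \<in> space M"
      then show "(g (W \<omega>) * pin (W \<omega>) k) * LX \<omega> j = indicator A \<omega> * (X k \<omega> * LX \<omega> j)"
        by (simp only: g(2) pin_W[OF _ k] mult.assoc)
    qed
    ultimately show ?thesis using False by simp
  qed
qed

text \<open>Testing against observed events identifies \<open>H\<close> as the conditional
  expectation of \<open>X i\<close>, so the residual is \<open>Y\<close> almost surely; the same
  test shows that the conditional expectation of its square is the constant
  \<open>v\<close>.\<close>

lemma cond_variance_constant: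
  assumes S: "S \<subseteq> V" and i: "i \<in> V"
    and dec: "\<And>\<omega>. \<omega> \<in> space M \<Longrightarrow> X i \<omega> = H \<omega> + Y \<omega>"
    and H: "H \<in> borel_measurable (observed M X S)" "integrable M H"
    and Y: "integrable M Y" "integrable M (\<lambda>\<omega>. (Y \<omega>)\<^sup>2)"
    and Y0: "\<And>A. A \<in> sets (observed M X S) \<Longrightarrow> expectation (\<lambda>\<omega>. indicator A \<omega> * Y \<omega>) = 0"
    and Yv: "\<And>A. A \<in> sets (observed M X S) \<Longrightarrow> expectation (\<lambda>\<omega>. indicator A \<omega> * (Y \<omega>)\<^sup>2) = v * prob A"
  shows "AE \<omega> in M. cond_variance M X S i \<omega> = v"
    and "integral\<^sup>L M (cond_variance M X S i) = v"
proof -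
  let ?F = "observed M X S"
  note sub = subalgebra_observed[OF S]
  interpret F: finite_measure_subalgebra M ?F
    by (unfold_locales) (rule sub)
  have AM: "A \<in> sets M" if "A \<in> sets ?F" for A using sub that by (auto simp: subalgebra_def)
  have int: "integrable M (\<lambda>\<omega>. indicator A \<omega> * f \<omega>)" if "A \<in> sets ?F" "integrable M f" for A and f :: "'a \<Rightarrow> real"
    using integrable_mult_indicator[OF AM[OF that(1)] that(2)] by simp
  have "AE \<omega> in M. real_cond_exp M ?F (X i) \<omega> = H \<omega>"
  proof (rule F.real_cond_exp_charact[OF _ X_integrable[OF i] H(2,1)])
    fix A assume A: "A \<in> sets ?F"
    have "(\<integral>\<omega>\<in>A. X i \<omega> \<partial>M) = expectation (\<lambda>\<omega>. indicator A \<omega> * H \<omega> + indicator A \<omega> * Y \<omega>)"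
      unfolding set_lebesgue_integral_def
      by (rule Bochner_Integration.integral_cong) (simp_all add: dec algebra_simps)
    also have "\<dots> = expectation (\<lambda>\<omega>. indicator A \<omega> * H \<omega>)"
      using int[OF A H(2)] int[OF A Y(1)] Y0[OF A] by simp
    finally show "(\<integral>\<omega>\<in>A. X i \<omega> \<partial>M) = (\<integral>\<omega>\<in>A. H \<omega> \<partial>M)"
      by (simp add: set_lebesgue_integral_def)
  qed
  then have "AE \<omega> in M. (X i \<omega> - real_cond_exp M ?F (X i) \<omega>)\<^sup>2 = (Y \<omega>)\<^sup>2"
    using AE_space by eventually_elim (simp add: dec)
  then have 1: "AE \<omega> in M. cond_variance M X S i \<omega> = real_cond_exp M ?F (\<lambda>\<omega>. (Y \<omega>)\<^sup>2) \<omega>"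
    unfolding cond_variance_def
  proof (rule F.real_cond_exp_cong)
    show "(\<lambda>\<omega>. (X i \<omega> - real_cond_exp M ?F (X i) \<omega>)\<^sup>2) \<in> borel_measurable M"
      using X_measurable[OF i] by measurable
    show "(\<lambda>\<omega>. (Y \<omega>)\<^sup>2) \<in> borel_measurable M" using Y(2) by blast
  qed
  have 2: "AE \<omega> in M. real_cond_exp M ?F (\<lambda>\<omega>. (Y \<omega>)\<^sup>2) \<omega> = v"
  proof (rule F.real_cond_exp_charact[OF _ Y(2)])
    fix A assume A: "A \<in> sets ?F"
    show "(\<integral>\<omega>\<in>A. (Y \<omega>)\<^sup>2 \<partial>M) = (\<integral>\<omega>\<in>A. v \<partial>M)"
      using Yv[OF A] AM[OF A] by (simp add: set_lebesgue_integral_def mult.commute)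
  qed simp_all
  show AE: "AE \<omega> in M. cond_variance M X S i \<omega> = v"
    using 1 2 by eventually_elim simp
  have "integral\<^sup>L M (cond_variance M X S i) = expectation (\<lambda>_. v)"
    using AE by (intro integral_cong_AE) (simp_all add: cond_variance_def)
  then show "integral\<^sup>L M (cond_variance M X S i) = v" by (simp add: prob_space)
qed

lemma cond_variance_green:
  assumes S: "S \<in> observation_sets n" and G: "green S G" and i: "i \<in> V"
  shows "AE \<omega> in M. cond_variance M X S i \<omega> = G i i"
    and "integral\<^sup>L M (cond_variance M X S i) = G i i"
proof -
  have S': "S \<subseteq> V" "1 \<in> S" using S by (auto simp: observation_sets_def)
  have "\<exists>H Y. (\<forall>\<omega>\<in>space M. X i \<omega> = H \<omega> + Y \<omega>) \<and> H \<in> borel_measurable (observed M X S) \<and>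
      integrable M H \<and> integrable M Y \<and> integrable M (\<lambda>\<omega>. (Y \<omega>)\<^sup>2) \<and>
      (\<forall>A\<in>sets (observed M X S). expectation (\<lambda>\<omega>. indicator A \<omega> * Y \<omega>) = 0 \<and>
        expectation (\<lambda>\<omega>. indicator A \<omega> * (Y \<omega>)\<^sup>2) = G i i * prob A)"
  proof (cases "i \<in> S")
    case True
    \<comment> \<open>An observed node is its own predictor with residual 0, and
      \<open>G i i = 0\<close>.\<close>
    then show ?thesis
      using X_integrable[OF i] observed_measurable[OF True] green_zero[OF G, of i i]
      by (intro exI[of _ "X i"] exI[of _ "\<lambda>_. 0"]) simp
  next
    case False
    then have iS: "i \<in> V - S" using i by simp
    \<comment> \<open>\<open>H\<close> is the predictor built from the observed nodes, with the
      boundary coefficients of \<open>green_sum_Lap\<close>; \<open>Y\<close> is the prediction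
      error.\<close>
    define a where "a l = Lap (\<lambda>t. G t i) l" for l
    define H where "H \<omega> = - (\<Sum>l\<in>S. a l * X l \<omega>)" for \<omega>
    define Y where "Y \<omega> = (\<Sum>j\<in>V - S. G j i * LX \<omega> j)" for \<omega>
    \<comment> \<open>Self-adjointness moves \<open>Lap\<close> from \<open>X\<close> to column
      \<open>i\<close> of \<open>G\<close>, where it is a delta off \<open>S\<close>.\<close>
    have Y_eq: "Y \<omega> = X i \<omega> + (\<Sum>l\<in>S. a l * X l \<omega>)" for \<omega>
    proof -
      have "Y \<omega> = (\<Sum>j\<in>V. G j i * LX \<omega> j)"
        unfolding Y_def by (rule sum.mono_neutral_left) (auto simp: green_zero[OF G])
      also have "\<dots> = (\<Sum>j\<in>V. X j \<omega> * a j)" unfolding a_def by (rule Lap_symmetric)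
      also have "\<dots> = X i \<omega> + (\<Sum>l\<in>S. a l * X l \<omega>)"
        using green_sum_Lap[OF G iS S'(1), of "\<lambda>j. X j \<omega>"] by (simp only: a_def mult.commute)
      finally show ?thesis .
    qed
    have SV: "l \<in> V" if "l \<in> S" for l using S'(1) that by blast
    have Y_LX: "Y \<omega> * LX \<omega> j = X i \<omega> * LX \<omega> j + (\<Sum>l\<in>S. a l * (X l \<omega> * LX \<omega> j))" for \<omega> j
      unfolding Y_eq by (simp add: distrib_right sum_distrib_right mult.assoc)
    have Y_LX_int: "integrable M (\<lambda>\<omega>. Y \<omega> * LX \<omega> j)" if "j \<in> V" for j
      unfolding Y_LX using that i SV
      by (intro Bochner_Integration.integrable_add Bochner_Integration.integrable_sum
          integrable_mult_right X_LX_integrable)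
    \<comment> \<open>Only one factor \<open>Y\<close> is expanded, which reduces the second moment
      to pairings of \<open>Y\<close> with \<open>LX \<omega> j\<close>.\<close>
    have Y_sq: "(Y \<omega>)\<^sup>2 = (\<Sum>j\<in>V - S. G j i * (Y \<omega> * LX \<omega> j))" for \<omega>
    proof -
      have "(Y \<omega>)\<^sup>2 = (\<Sum>j\<in>V - S. G j i * LX \<omega> j) * Y \<omega>" by (simp add: power2_eq_square Y_def)
      then show ?thesis by (simp add: sum_distrib_right sum_distrib_left ac_simps)
    qed
    have H_meas: "H \<in> borel_measurable (observed M X S)"
      unfolding H_def
      by (intro borel_measurable_uminus borel_measurable_sum borel_measurable_times
          borel_measurable_const observed_measurable)
    have H_int: "integrable M H"
      unfolding H_def
      by (intro Bochner_Integration.integrable_minus Bochner_Integration.integrable_sum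
          integrable_mult_right X_integrable SV)
    have Y_int: "integrable M Y"
      unfolding Y_def
      by (intro Bochner_Integration.integrable_sum integrable_mult_right LX_integrable) blast
    have Y_sq_int: "integrable M (\<lambda>\<omega>. (Y \<omega>)\<^sup>2)"
      unfolding Y_sq
      by (intro Bochner_Integration.integrable_sum integrable_mult_right Y_LX_int) blast
    have moments: "expectation (\<lambda>\<omega>. indicator A \<omega> * Y \<omega>) = 0 \<and>
        expectation (\<lambda>\<omega>. indicator A \<omega> * (Y \<omega>)\<^sup>2) = G i i * prob A"
      if A: "A \<in> sets (observed M X S)" for A
    proof
      have AM: "A \<in> sets M" using subalgebra_observed[OF S'(1)] A by (auto simp: subalgebra_def)
      have int: "integrable M (\<lambda>\<omega>. indicator A \<omega> * f \<omega>)" if "integrable M f" for f :: "'a \<Rightarrow> real"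
        using integrable_mult_indicator[OF AM that] by simp
      have lin: "expectation (\<lambda>\<omega>. indicator A \<omega> * (\<Sum>j\<in>J. b j * f j \<omega>)) =
          (\<Sum>j\<in>J. b j * expectation (\<lambda>\<omega>. indicator A \<omega> * f j \<omega>))"
        if "\<And>j. j \<in> J \<Longrightarrow> integrable M (f j)" for J :: "nat set" and b :: "nat \<Rightarrow> real" and f
      proof -
        have "(\<lambda>\<omega>. indicator A \<omega> * (\<Sum>j\<in>J. b j * f j \<omega>)) =
            (\<lambda>\<omega>. \<Sum>j\<in>J. b j * (indicator A \<omega> * f j \<omega>))"
          by (simp add: sum_distrib_left mult.left_commute)
        then show ?thesis
          using int[OF that] by (simp add: Bochner_Integration.integral_sum)
      qed
      show "expectation (\<lambda>\<omega>. indicator A \<omega> * Y \<omega>) = 0"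
        unfolding Y_def
        by (subst lin) (auto intro!: LX_integrable sum.neutral simp: laplacian_moments(1)[OF S A])
      \<comment> \<open>Every \<open>l\<close> in \<open>S\<close> differs from \<open>j\<close>, so
        in the expansion of \<open>Y\<close> only the term \<open>X i\<close> can pair with
        \<open>LX \<omega> j\<close>, and that only for \<open>j = i\<close>.\<close>
      have E: "expectation (\<lambda>\<omega>. indicator A \<omega> * (Y \<omega> * LX \<omega> j)) = (if j = i then prob A else 0)"
        if j: "j \<in> V - S" for j
      proof -
        have jV: "j \<in> V" using j by blast
        have "expectation (\<lambda>\<omega>. indicator A \<omega> * (Y \<omega> * LX \<omega> j)) =
            expectation (\<lambda>\<omega>. indicator A \<omega> * (X i \<omega> * LX \<omega> j) +
              indicator A \<omega> * (\<Sum>l\<in>S. a l * (X l \<omega> * LX \<omega> j)))"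
          unfolding Y_LX distrib_left ..
        also have "\<dots> = expectation (\<lambda>\<omega>. indicator A \<omega> * (X i \<omega> * LX \<omega> j)) +
            expectation (\<lambda>\<omega>. indicator A \<omega> * (\<Sum>l\<in>S. a l * (X l \<omega> * LX \<omega> j)))"
          using i jV SV
          by (intro Bochner_Integration.integral_add int Bochner_Integration.integrable_sum
              integrable_mult_right X_LX_integrable)
        also have "expectation (\<lambda>\<omega>. indicator A \<omega> * (\<Sum>l\<in>S. a l * (X l \<omega> * LX \<omega> j))) =
            (\<Sum>l\<in>S. a l * expectation (\<lambda>\<omega>. indicator A \<omega> * (X l \<omega> * LX \<omega> j)))"
          by (rule lin) (intro X_LX_integrable SV jV)
        also have "\<dots> = 0"
        proof (rule sum.neutral, rule ballI)
          fix l assume l: "l \<in> S"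
          then have "l \<noteq> j" using j by blast
          then show "a l * expectation (\<lambda>\<omega>. indicator A \<omega> * (X l \<omega> * LX \<omega> j)) = 0"
            using laplacian_moments(2)[OF S A j SV[OF l]] by simp
        qed
        finally show ?thesis using laplacian_moments(2)[OF S A j i] by auto
      qed
      have "expectation (\<lambda>\<omega>. indicator A \<omega> * (Y \<omega>)\<^sup>2) =
          (\<Sum>j\<in>V - S. G j i * expectation (\<lambda>\<omega>. indicator A \<omega> * (Y \<omega> * LX \<omega> j)))"
        unfolding Y_sq by (rule lin) (use Y_LX_int in blast)
      also have "\<dots> = (\<Sum>j\<in>V - S. if j = i then G j i * prob A else 0)"
        by (intro sum.cong refl) (simp add: E)
      also have "\<dots> = G i i * prob A" using iS by simp
      finally show "expectation (\<lambda>\<omega>. indicator A \<omega> * (Y \<omega>)\<^sup>2) = G i i * prob A" .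
    qed
    show ?thesis
      by (intro exI[of _ H] exI[of _ Y] conjI ballI H_meas H_int Y_int Y_sq_int
          moments[THEN conjunct1] moments[THEN conjunct2]) (simp_all add: Y_eq H_def)
  qed
  then obtain H Y where *: "\<And>\<omega>. \<omega> \<in> space M \<Longrightarrow> X i \<omega> = H \<omega> + Y \<omega>"
    "H \<in> borel_measurable (observed M X S)" "integrable M H" "integrable M Y"
    "integrable M (\<lambda>\<omega>. (Y \<omega>)\<^sup>2)"
    "\<And>A. A \<in> sets (observed M X S) \<Longrightarrow> expectation (\<lambda>\<omega>. indicator A \<omega> * Y \<omega>) = 0"
    "\<And>A. A \<in> sets (observed M X S) \<Longrightarrow> expectation (\<lambda>\<omega>. indicator A \<omega> * (Y \<omega>)\<^sup>2) = G i i * prob A"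
    by blast
  show "AE \<omega> in M. cond_variance M X S i \<omega> = G i i"
    by (rule cond_variance_constant(1)[OF S'(1) i *])
  show "integral\<^sup>L M (cond_variance M X S i) = G i i"
    by (rule cond_variance_constant(2)[OF S'(1) i *])
qed

text \<open>Both claims sum the diagonal of \<open>G\<close>. The second shows that the expectation
  in \<open>err\<close> only removes null sets: each conditional variance is almost surely constant,
  and there are finitely many of them.\<close>

lemma err_eq:
  assumes S: "S \<in> observation_sets n"
  shows "err n M X S = 1 / real n * trace_inverse n E r S"
    and "AE \<omega> in M. err n M X S = 1 / real n * (\<Sum>i\<in>V. cond_variance M X S i \<omega>)"
proof -
  obtain G where G: "green S G" and tr: "trace_inverse n E r S = (\<Sum>i\<in>V. G i i)"
    using green_exists[OF S] by blast
  have "(\<Sum>i\<in>V. integral\<^sup>L M (cond_variance M X S i)) = (\<Sum>i\<in>V. G i i)"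
    by (intro sum.cong refl cond_variance_green(2)[OF S G])
  then show e: "err n M X S = 1 / real n * trace_inverse n E r S"
    unfolding err_def tr by simp
  have "AE \<omega> in M. \<forall>i\<in>V. cond_variance M X S i \<omega> = G i i"
    by (intro AE_finite_allI cond_variance_green(1)[OF S G]) simp
  then show "AE \<omega> in M. err n M X S = 1 / real n * (\<Sum>i\<in>V. cond_variance M X S i \<omega>)"
    unfolding e tr by eventually_elim simp
qed

end

text \<open>Invertibility is asserted because \<open>trace_inverse\<close> extracts the inverse from
  an option by \<open>the\<close>. The claims on \<open>err\<close> follow from those on
  \<open>trace_inverse\<close> by scaling with the nonnegative constant
  \<open>1 / real n\<close>.\<close>

theorem lemma8:
  fixes n :: nat and E :: "nat set set" and r :: "nat \<Rightarrow> nat \<Rightarrow> real"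
    and M :: "'a measure" and X :: "nat \<Rightarrow> 'a \<Rightarrow> real"
  assumes "weighted_connected_graph n E r"
    and "gaussian_free_field n E r M X"
  shows "(\<forall>S\<in>observation_sets n.
            invertible_mat (block (laplacian n E r) ({1..n} - S) ({1..n} - S)) \<and>
            (AE \<omega> in M. err n M X S = 1 / real n * (\<Sum>i\<in>{1..n}. cond_variance M X S i \<omega>)) \<and>
            err n M X S = 1 / real n * trace_inverse n E r S) \<and>
         antimono_on (observation_sets n) (err n M X) \<and>
         supermodular n (err n M X) \<and>
         antimono_on (observation_sets n) (trace_inverse n E r) \<and>
         supermodular n (trace_inverse n E r)"
proof -
  interpret gff_network n E r M X
    by unfold_locales (rule assms)+
  have inv: "invertible_mat (block (laplacian n E r) ({1..n} - S) ({1..n} - S))"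
    if "S \<in> observation_sets n" for S
    using green_exists[OF that] by blast
  have mono: "antimono_on (observation_sets n) (err n M X)"
  proof (rule monotone_onI)
    fix A B assume AB: "A \<in> observation_sets n" "B \<in> observation_sets n" "A \<subseteq> B"
    have "trace_inverse n E r B \<le> trace_inverse n E r A"
      using monotone_onD[OF trace_inverse_antimono AB] .
    then show "err n M X B \<le> err n M X A"
      unfolding err_eq(1)[OF AB(1)] err_eq(1)[OF AB(2)] by (intro mult_left_mono) simp_all
  qed
  have "supermodular n (err n M X)"
    unfolding supermodular_def
  proof (intro ballI)
    fix A x y assume A: "A \<in> observation_sets n" and x: "x \<in> {1..n}" and y: "y \<in> {1..n}"
    have "A \<union> {x} \<in> observation_sets n" "A \<union> {y} \<in> observation_sets n" "A \<union> {x, y} \<in> observation_sets n"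
      using A x y by (auto simp: observation_sets_def)
    note e = err_eq(1)[OF A] this[THEN err_eq(1)]
    have "trace_inverse n E r (A \<union> {y}) - trace_inverse n E r (A \<union> {x, y}) \<le>
        trace_inverse n E r A - trace_inverse n E r (A \<union> {x})"
      using trace_inverse_supermodular A x y unfolding supermodular_def by blast
    then show "err n M X (A \<union> {y}) - err n M X (A \<union> {x, y}) \<le> err n M X A - err n M X (A \<union> {x})"
      unfolding e right_diff_distrib[symmetric] by (intro mult_left_mono) simp_all
  qed
  then show ?thesis
    using inv err_eq mono trace_inverse_antimono trace_inverse_supermodular by blast
qed

end
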